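(* Let $n\ge1$, assume $-1<m\le\frac{n-4}{2}$, and let $W$ be a Bessel potential on $(0,R)$, with $B\subset\mathbb{R}^n$ the ball of radius $R$ centered at zero. Then for all $u\in C_0^\infty(B)$ $$\int_B\frac{|\Delta u|^2}{|x|^{2m}}dx\ge\frac{(n+2m)^2(n-2m-4)^2}{16}\int_B\frac{u^2}{|x|^{2m+4}}dx+\beta(W;R)\frac{(n+2m)^2}{4}\int_B\frac{W(x)}{|x|^{2m+2}}u^2dx+\beta(r^{2m};R)\,\|u\|_{H_0^1}^2 .$$
   Context: A non-negative $C^1$ function $W$ on $(0,R)$ is a Bessel potential on $(0,R)$ if there is $c>0$ such that $y''+\frac1r y'+cW(r)y=0$ has a positive solution on $(0,R)$; its weight $\beta(W;R)$ is the supremum of all such $c$; $\beta(r^{2m};R)$ is the weight of the function $r\mapsto r^{2m}$ (a Bessel potential since $2m>-2$). One writes $W(x)=W(|x|)$. $\|u\|_{H_0^1}^2=\int_B|\nabla u|^2dx$. *)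

theory Defs
  imports "HOL-Analysis.Analysis"
begin

definition partial_deriv :: "'n \<Rightarrow> (real ^ 'n::finite \<Rightarrow> real) \<Rightarrow> real ^ 'n \<Rightarrow> real" where
  "partial_deriv i f x = frechet_derivative f (at x) (axis i 1)"

definition grad :: "(real ^ 'n::finite \<Rightarrow> real) \<Rightarrow> real ^ 'n \<Rightarrow> real ^ 'n" where
  "grad f x = (\<chi> i. partial_deriv i f x)"

definition laplacian :: "(real ^ 'n::finite \<Rightarrow> real) \<Rightarrow> real ^ 'n \<Rightarrow> real" where
  "laplacian f x = (\<Sum>i\<in>UNIV. partial_deriv i (partial_deriv i f) x)"

primrec Ck :: "nat \<Rightarrow> (real ^ 'n::finite \<Rightarrow> real) \<Rightarrow> bool" where
  "Ck 0 f \<longleftrightarrow> continuous_on UNIV f"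
| "Ck (Suc k) f \<longleftrightarrow> (\<forall>x. f differentiable (at x)) \<and> (\<forall>i. Ck k (partial_deriv i f))"

text \<open>Functions in \<open>C\<^sub>0\<^sup>\<infinity>(\<Omega>)\<close> are represented by their extensions by zero to the whole space.\<close>

definition test_function :: "(real ^ 'n::finite) set \<Rightarrow> (real ^ 'n \<Rightarrow> real) \<Rightarrow> bool" where
  "test_function \<Omega> u \<longleftrightarrow>
     (\<forall>k. Ck k u) \<and> compact (closure {x. u x \<noteq> 0}) \<and> closure {x. u x \<noteq> 0} \<subseteq> \<Omega>"

definition has_positive_bessel_solution :: "(real \<Rightarrow> real) \<Rightarrow> real \<Rightarrow> real \<Rightarrow> bool" where
  "has_positive_bessel_solution W R c \<longleftrightarrow>
     (\<exists>y y' y''. \<forall>r\<in>{0<..<R}.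
        (y has_real_derivative y' r) (at r) \<and>
        (y' has_real_derivative y'' r) (at r) \<and>
        y'' r + 1 / r * y' r + c * W r * y r = 0 \<and> y r > 0)"

definition bessel_potential :: "(real \<Rightarrow> real) \<Rightarrow> real \<Rightarrow> bool" where
  "bessel_potential W R \<longleftrightarrow>
     W C1_differentiable_on {0<..<R} \<and> (\<forall>r\<in>{0<..<R}. W r \<ge> 0) \<and>
     (\<exists>c>0. has_positive_bessel_solution W R c)"

text \<open>The supremum is taken in the extended non-negative reals: for \<open>W = 0\<close> every \<open>c\<close> is
  admissible and the weight is infinite.\<close>

definition bessel_weight :: "(real \<Rightarrow> real) \<Rightarrow> real \<Rightarrow> ennreal" where
  "bessel_weight W R = (SUP c\<in>{c. c > 0 \<and> has_positive_bessel_solution W R c}. ennreal c)"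

end

theory Submission imports Defs begin

text \<open>
  Write \<open>E = x \<cdot> \<nabla>\<close> for the Euler operator and \<open>L\<^sub>i\<^sub>j = x\<^sub>i \<partial>\<^sub>j - x\<^sub>j \<partial>\<^sub>i\<close>
  for the angular derivatives. They commute, and \<open>|x|\<^sup>2 \<Delta> = E\<^sup>2 + (n - 2) E + 1/2 \<Sum> L\<^sub>i\<^sub>j\<^sup>2\<close>; these
  operators replace the expansion into spherical harmonics. Squaring this decomposition with the
  weight \<open>|x| powr (-q)\<close>, \<open>q = 2 m + 4\<close>, discarding the square of the angular part and integrating by
  parts, one is left with the integrals of \<open>(E\<^sup>2 u)\<^sup>2\<close>, \<open>(E u)\<^sup>2\<close> and \<open>(E L\<^sub>i\<^sub>j u)\<^sup>2\<close>, up to nonnegative terms.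

  A positive solution \<open>y\<close> of the Bessel equation yields \<open>s = - r y' / y \<ge> 0\<close> with the Riccati equation
  \<open>r s' = c W r\<^sup>2 + s\<^sup>2\<close>, and integrating \<open>(E f + ((n - q) / 2 + s) f)\<^sup>2 \<ge> 0\<close> gives the improved Hardy
  inequality for \<open>f\<close>. It is applied to \<open>E u\<close> and to \<open>L\<^sub>i\<^sub>j u\<close> with the potential \<open>r powr (2 m)\<close>, which
  produces the Dirichlet integral, and to \<open>u\<close> with the potential \<open>W\<close>.

  The weights are cut off at \<open>|x| \<le> \<epsilon>\<close>. In the Hardy inequality the cutoff term has the good sign; in
  the expansion of the square the error is \<open>O(\<epsilon>\<^sup>2)\<close>.
\<close>

subsection \<open>Smooth functions, the Euler operator and angular derivatives\<close>

lemma partial_deriv_eqI: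
  fixes f :: "real ^ 'n::finite \<Rightarrow> real"
  assumes "(f has_derivative f') (at x)"
  shows "partial_deriv i f x = f' (axis i 1)"
  using frechet_derivative_at[OF assms] by (simp add: partial_deriv_def)

lemma has_derivative_partial_deriv:
  fixes f :: "real ^ 'n::finite \<Rightarrow> real"
  assumes "f differentiable (at x)"
  shows "(f has_derivative (\<lambda>h. \<Sum>i\<in>UNIV. h $ i * partial_deriv i f x)) (at x)"
proof -
  let ?D = "frechet_derivative f (at x)"
  have D: "(f has_derivative ?D) (at x)"
    using assms frechet_derivative_works by blast
  then interpret bounded_linear ?D by (rule has_derivative_bounded_linear)
  have "?D h = (\<Sum>i\<in>UNIV. h $ i * partial_deriv i f x)" for h
  proof -
    have "?D h = ?D (\<Sum>i\<in>UNIV. h $ i *\<^sub>R axis i 1)"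
      using basis_expansion[of h] by (simp add: scalar_mult_eq_scaleR)
    also have "\<dots> = (\<Sum>i\<in>UNIV. h $ i * partial_deriv i f x)"
      by (simp add: sum scaleR partial_deriv_def)
    finally show ?thesis .
  qed
  then have "?D = (\<lambda>h. \<Sum>i\<in>UNIV. h $ i * partial_deriv i f x)" by blast
  with D show ?thesis by simp
qed

lemma partial_deriv_const [simp]: "partial_deriv i (\<lambda>x. c) x = 0"
  by (subst partial_deriv_eqI[where f' = "\<lambda>_. 0"]) auto

lemma partial_deriv_nth [simp]:
  "partial_deriv i (\<lambda>x. x $ j) x = (if i = j then 1 else 0)"
proof -
  have "((\<lambda>x. x $ j) has_derivative (\<lambda>h. h $ j)) (at x)"
    by (rule bounded_linear_imp_has_derivative[OF bounded_linear_vec_nth])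
  from partial_deriv_eqI[OF this] show ?thesis by (auto simp: axis_def)
qed

lemma partial_deriv_mult:
  assumes "f differentiable (at x)" "g differentiable (at x)"
  shows "partial_deriv i (\<lambda>x. f x * g x) x = partial_deriv i f x * g x + f x * partial_deriv i g x"
proof -
  have "((\<lambda>x. f x * g x) has_derivative
      (\<lambda>h. f x * (\<Sum>i\<in>UNIV. h $ i * partial_deriv i g x) + (\<Sum>i\<in>UNIV. h $ i * partial_deriv i f x) * g x)) (at x)"
    by (intro has_derivative_mult has_derivative_partial_deriv assms)
  from partial_deriv_eqI[OF this, of i] show ?thesis
    by (simp add: axis_def if_distrib[of "\<lambda>z. z * _"] cong: if_cong)
qed

lemma partial_deriv_add:
  assumes "f differentiable (at x)" "g differentiable (at x)"
  shows "partial_deriv i (\<lambda>x. f x + g x) x = partial_deriv i f x + partial_deriv i g x"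
proof -
  have "((\<lambda>x. f x + g x) has_derivative
      (\<lambda>h. (\<Sum>i\<in>UNIV. h $ i * partial_deriv i f x) + (\<Sum>i\<in>UNIV. h $ i * partial_deriv i g x))) (at x)"
    by (intro has_derivative_add has_derivative_partial_deriv assms)
  from partial_deriv_eqI[OF this, of i] show ?thesis
    by (simp add: axis_def if_distrib[of "\<lambda>z. z * _"] cong: if_cong)
qed

section \<open>The algebra of smooth functions\<close>

text \<open>Continuity is not a clause of \<open>Ck (Suc k)\<close>; at the bottom of the induction
  it is recovered from differentiability.\<close>

lemma Ck_SucD: "Ck (Suc k) f \<Longrightarrow> Ck k f"
proof (induction k arbitrary: f)
  case 0
  then show ?case
    by (auto intro!: continuous_at_imp_continuous_on differentiable_imp_continuous_within)
qed auto

lemma Ck_const: "Ck k (\<lambda>x. c)"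
proof (induction k arbitrary: c)
  case (Suc k)
  have "partial_deriv i (\<lambda>x. c) = (\<lambda>x. 0)" for i :: 'a by (rule ext) simp
  with Suc show ?case by simp
qed simp

lemma Ck_add: "Ck k f \<Longrightarrow> Ck k g \<Longrightarrow> Ck k (\<lambda>x. f x + g x)"
proof (induction k arbitrary: f g)
  case (Suc k)
  have "partial_deriv i (\<lambda>x. f x + g x) = (\<lambda>x. partial_deriv i f x + partial_deriv i g x)" for i
    using Suc.prems by (auto simp: partial_deriv_add)
  with Suc show ?case by simp
qed (simp add: continuous_on_add)

lemma Ck_mult: "Ck k f \<Longrightarrow> Ck k g \<Longrightarrow> Ck k (\<lambda>x. f x * g x)"
proof (induction k arbitrary: f g)
  case (Suc k)
  have "partial_deriv i (\<lambda>x. f x * g x)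
      = (\<lambda>x. partial_deriv i f x * g x + f x * partial_deriv i g x)" for i
    using Suc.prems by (auto simp: partial_deriv_mult)
  moreover have "Ck k f" "Ck k g" using Suc.prems Ck_SucD by blast+
  ultimately show ?case using Suc by (simp add: Ck_add)
qed (simp add: continuous_on_mult)

lemma Ck_nth: "Ck k (\<lambda>x. x $ j)"
proof (cases k)
  case (Suc l)
  have "partial_deriv i (\<lambda>x. x $ j) = (\<lambda>x. if i = j then 1 else 0)" for i
    by (rule ext) simp
  then show ?thesis using Suc
    by (auto simp: Ck_const intro!: bounded_linear_imp_differentiable bounded_linear_vec_nth)
qed (simp add: continuous_on_component)

definition smooth :: "(real ^ 'n::finite \<Rightarrow> real) \<Rightarrow> bool" where
  "smooth f \<longleftrightarrow> (\<forall>k. Ck k f)"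

lemma smooth_differentiable: "smooth f \<Longrightarrow> f differentiable (at x)"
  unfolding smooth_def using Ck.simps(2)[of 0 f] by blast

lemma smooth_continuous: "smooth f \<Longrightarrow> continuous_on A f"
  by (meson continuous_at_imp_continuous_on differentiable_imp_continuous_within smooth_differentiable)

lemma smooth_partial_deriv: "smooth f \<Longrightarrow> smooth (partial_deriv i f)"
  unfolding smooth_def by (metis Ck.simps(2))

lemma smooth_const: "smooth (\<lambda>x. c)"
  and smooth_nth: "smooth (\<lambda>x. x $ j)"
  and smooth_add: "smooth f \<Longrightarrow> smooth g \<Longrightarrow> smooth (\<lambda>x. f x + g x)"
  and smooth_mult: "smooth f \<Longrightarrow> smooth g \<Longrightarrow> smooth (\<lambda>x. f x * g x)"
  by (simp_all add: smooth_def Ck_const Ck_nth Ck_add Ck_mult)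

lemma smooth_diff:
  assumes "smooth f" "smooth g" shows "smooth (\<lambda>x. f x - g x)"
  using smooth_add[OF assms(1) smooth_mult[OF smooth_const[of "-1"] assms(2)]] by simp

lemma smooth_sum: "(\<And>i. i \<in> I \<Longrightarrow> smooth (f i)) \<Longrightarrow> smooth (\<lambda>x. \<Sum>i\<in>I. f i x)"
proof (induction I rule: infinite_finite_induct)
  case (insert i I)
  then show ?case by (simp add: smooth_add)
qed (auto simp: smooth_const)

lemma partial_deriv_sum:
  assumes "\<And>i. i \<in> I \<Longrightarrow> smooth (f i)"
  shows "partial_deriv k (\<lambda>x. \<Sum>i\<in>I. f i x) x = (\<Sum>i\<in>I. partial_deriv k (f i) x)"
  using assms
proof (induction I rule: infinite_finite_induct)
  case (insert i I)
  then show ?case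
    by (simp add: partial_deriv_add smooth_differentiable smooth_sum)
qed auto

section \<open>Symmetry of second derivatives\<close>

lemma partial_deriv_along_line:
  fixes f :: "real ^ 'n::finite \<Rightarrow> real"
  assumes "smooth f"
  shows "((\<lambda>t. f (y + t *\<^sub>R axis i 1)) has_real_derivative partial_deriv i f (y + t *\<^sub>R axis i 1)) (at t)"
proof -
  let ?x = "y + t *\<^sub>R axis i 1"
  have "((\<lambda>t. f (y + t *\<^sub>R axis i 1)) has_derivative
      (\<lambda>h. \<Sum>k\<in>UNIV. (h *\<^sub>R axis i 1 :: real ^ 'n) $ k * partial_deriv k f ?x)) (at t)"
    by (rule has_derivative_compose[where f = "\<lambda>t. y + t *\<^sub>R axis i 1"])
       (auto intro!: derivative_eq_intros has_derivative_partial_deriv smooth_differentiable assms)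
  moreover have "(\<lambda>h. \<Sum>k\<in>UNIV. (h *\<^sub>R axis i 1 :: real ^ 'n) $ k * partial_deriv k f ?x)
      = (*) (partial_deriv i f ?x)"
    by (rule ext) (simp add: axis_def if_distrib[of "\<lambda>z. z * _"] if_distrib[of "\<lambda>z. _ * z"] mult.commute cong: if_cong)
  ultimately show ?thesis
    by (simp add: has_field_derivative_def)
qed

text \<open>Two one-variable mean value steps: first in direction \<open>i\<close> for the
  difference of \<open>f\<close> along two parallel segments, then in direction \<open>j\<close> for
  the partial derivative that this produces.\<close>

lemma second_difference_mean_value:
  fixes f :: "real ^ 'n::finite \<Rightarrow> real"
  assumes "smooth f" "h > 0"
  shows "\<exists>s t. 0 < s \<and> s < h \<and> 0 < t \<and> t < h \<and>
    f (x + h *\<^sub>R axis i 1 + h *\<^sub>R axis j 1) - f (x + h *\<^sub>R axis i 1) - f (x + h *\<^sub>R axis j 1) + f x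
      = h\<^sup>2 * partial_deriv j (partial_deriv i f) (x + s *\<^sub>R axis i 1 + t *\<^sub>R axis j 1)"
proof -
  define a :: "real ^ 'n" where "a = axis i 1"
  define b :: "real ^ 'n" where "b = axis j 1"
  have "((\<lambda>t. f ((x + h *\<^sub>R b) + t *\<^sub>R a) - f (x + t *\<^sub>R a)) has_real_derivative
      partial_deriv i f ((x + h *\<^sub>R b) + t *\<^sub>R a) - partial_deriv i f (x + t *\<^sub>R a)) (at t)" for t
    unfolding a_def by (intro DERIV_diff partial_deriv_along_line assms)
  from MVT2[OF assms(2) this] obtain s where s: "0 < s" "s < h"
    "f (x + h *\<^sub>R b + h *\<^sub>R a) - f (x + h *\<^sub>R a) - (f (x + h *\<^sub>R b) - f x)
      = h * (partial_deriv i f ((x + h *\<^sub>R b) + s *\<^sub>R a) - partial_deriv i f (x + s *\<^sub>R a))"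
    by auto
  have "((\<lambda>t. partial_deriv i f ((x + s *\<^sub>R a) + t *\<^sub>R b)) has_real_derivative
      partial_deriv j (partial_deriv i f) ((x + s *\<^sub>R a) + t *\<^sub>R b)) (at t)" for t
    unfolding b_def by (intro partial_deriv_along_line smooth_partial_deriv assms)
  from MVT2[OF assms(2) this] obtain t where t: "0 < t" "t < h"
    "partial_deriv i f (x + s *\<^sub>R a + h *\<^sub>R b) - partial_deriv i f (x + s *\<^sub>R a)
      = h * partial_deriv j (partial_deriv i f) (x + s *\<^sub>R a + t *\<^sub>R b)"
    by auto
  have "f (x + h *\<^sub>R a + h *\<^sub>R b) - f (x + h *\<^sub>R a) - f (x + h *\<^sub>R b) + f x
      = h\<^sup>2 * partial_deriv j (partial_deriv i f) (x + s *\<^sub>R a + t *\<^sub>R b)"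
    using s(3) t(3) by (simp add: add_ac power2_eq_square)
  with s t show ?thesis unfolding a_def b_def by blast
qed

text \<open>The second difference quotient is symmetric in the two directions, and by its mean value
  form it is a mixed derivative at a point tending to \<open>x\<close>. Both orders are therefore
  limits of the same sequence.\<close>

lemma partial_deriv_commute:
  fixes f :: "real ^ 'n::finite \<Rightarrow> real"
  assumes "smooth f"
  shows "partial_deriv i (partial_deriv j f) x = partial_deriv j (partial_deriv i f) x"
proof -
  define Q where "Q = (\<lambda>i j h. (f (x + h *\<^sub>R axis i 1 + h *\<^sub>R axis j 1) - f (x + h *\<^sub>R axis i 1)
    - f (x + h *\<^sub>R axis j 1) + f x) / h\<^sup>2)"
  have lim: "(\<lambda>k. Q i j (1 / Suc k)) \<longlonglongrightarrow> partial_deriv j (partial_deriv i f) x" for i j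
  proof -
    have "\<exists>s t. 0 < s \<and> s < 1 / Suc k \<and> 0 < t \<and> t < 1 / Suc k \<and>
        Q i j (1 / Suc k) = partial_deriv j (partial_deriv i f) (x + s *\<^sub>R axis i 1 + t *\<^sub>R axis j 1)" for k
      using second_difference_mean_value[OF assms, of "1 / Suc k" x i j] by (fastforce simp: Q_def field_simps)
    then obtain s t where st: "\<And>k. 0 < s k \<and> s k < 1 / Suc k \<and> 0 < t k \<and> t k < 1 / Suc k \<and>
        Q i j (1 / Suc k) = partial_deriv j (partial_deriv i f) (x + s k *\<^sub>R axis i 1 + t k *\<^sub>R axis j 1)"
      by metis
    have "s \<longlonglongrightarrow> 0" "t \<longlonglongrightarrow> 0"
      using st by (auto intro!: tendsto_sandwich[OF _ _ tendsto_const lim_1_over_n[THEN LIMSEQ_Suc]]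
          eventuallyI less_imp_le)
    then have *: "(\<lambda>k. x + s k *\<^sub>R axis i 1 + t k *\<^sub>R axis j 1) \<longlonglongrightarrow> x + 0 *\<^sub>R axis i 1 + 0 *\<^sub>R axis j 1"
      by (intro tendsto_intros)
    have "isCont (partial_deriv j (partial_deriv i f)) x"
      using assms by (intro differentiable_imp_continuous_within smooth_differentiable smooth_partial_deriv)
    with * st show ?thesis by (auto intro: isCont_tendsto_compose)
  qed
  have "Q i j h = Q j i h" for h by (simp add: Q_def add_ac)
  then show ?thesis using lim[of i j] lim[of j i] LIMSEQ_unique by auto
qed

section \<open>Dilations, rotations and the Laplacian\<close>

definition euler :: "(real ^ 'n::finite \<Rightarrow> real) \<Rightarrow> real ^ 'n \<Rightarrow> real" where
  "euler f x = (\<Sum>i\<in>UNIV. x $ i * partial_deriv i f x)"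

definition angular :: "'n \<Rightarrow> 'n \<Rightarrow> (real ^ 'n::finite \<Rightarrow> real) \<Rightarrow> real ^ 'n \<Rightarrow> real" where
  "angular i j f x = x $ i * partial_deriv j f x - x $ j * partial_deriv i f x"

lemma smooth_euler: "smooth f \<Longrightarrow> smooth (euler f)"
  unfolding euler_def[abs_def] by (intro smooth_sum smooth_mult smooth_nth smooth_partial_deriv)

lemma smooth_angular: "smooth f \<Longrightarrow> smooth (angular i j f)"
  unfolding angular_def[abs_def] by (intro smooth_diff smooth_mult smooth_nth smooth_partial_deriv)

lemma euler_mult:
  assumes "smooth f" "smooth g"
  shows "euler (\<lambda>x. f x * g x) x = euler f x * g x + f x * euler g x"
  using assms
  by (simp add: euler_def partial_deriv_mult smooth_differentiable algebra_simps sum.distrib sum_distrib_left)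

lemma angular_mult:
  assumes "smooth f" "smooth g"
  shows "angular i j (\<lambda>x. f x * g x) x = angular i j f x * g x + f x * angular i j g x"
  using assms
  by (simp add: angular_def partial_deriv_mult smooth_differentiable algebra_simps)

lemma partial_deriv_diff:
  assumes "smooth f" "smooth g"
  shows "partial_deriv i (\<lambda>x. f x - g x) x = partial_deriv i f x - partial_deriv i g x"
proof -
  have "partial_deriv i (\<lambda>x. (f x - g x) + g x) x = partial_deriv i (\<lambda>x. f x - g x) x + partial_deriv i g x"
    by (intro partial_deriv_add smooth_differentiable smooth_diff assms)
  then show ?thesis by simp
qed

lemma partial_deriv_angular:
  assumes "smooth f"
  shows "partial_deriv k (angular i j f) x =
    (if k = i then partial_deriv j f x else 0) + x $ i * partial_deriv k (partial_deriv j f) x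
    - (if k = j then partial_deriv i f x else 0) - x $ j * partial_deriv k (partial_deriv i f) x"
  unfolding angular_def[abs_def]
  by (simp add: partial_deriv_diff partial_deriv_mult smooth_differentiable smooth_mult smooth_nth
      smooth_partial_deriv assms)

lemma partial_deriv_euler:
  assumes "smooth f"
  shows "partial_deriv k (euler f) x =
    partial_deriv k f x + (\<Sum>i\<in>UNIV. x $ i * partial_deriv k (partial_deriv i f) x)"
  unfolding euler_def[abs_def]
  by (simp add: partial_deriv_sum partial_deriv_mult smooth_differentiable smooth_mult smooth_nth
      smooth_partial_deriv assms sum.distrib if_distrib[of "\<lambda>z. z * _"] cong: if_cong)

text \<open>Dilations commute with rotations. In coordinates the first-order terms agree, and the
  second-order ones are matched by \<open>partial_deriv_commute\<close>.\<close>

lemma angular_euler_commute: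
  assumes "smooth f"
  shows "angular i j (euler f) x = euler (angular i j f) x"
proof -
  have "euler (angular i j f) x = x $ i * partial_deriv j f x - x $ j * partial_deriv i f x
      + (x $ i * (\<Sum>k\<in>UNIV. x $ k * partial_deriv k (partial_deriv j f) x)
        - x $ j * (\<Sum>k\<in>UNIV. x $ k * partial_deriv k (partial_deriv i f) x))"
    unfolding euler_def[of "angular i j f"] partial_deriv_angular[OF assms]
    by (simp add: algebra_simps sum.distrib sum_subtractf sum_distrib_left
        if_distrib[of "\<lambda>z. _ * z"] cong: if_cong)
  also have "\<dots> = angular i j (euler f) x"
    unfolding angular_def partial_deriv_euler[OF assms] partial_deriv_commute[OF assms, of i]
      partial_deriv_commute[OF assms, of j]
    by (simp add: algebra_simps)
  finally show ?thesis by simp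
qed

text \<open>This is the polar form of the Laplacian: \<open>euler\<close> is r times the radial
  derivative, and half the double sum is the spherical Laplacian. On expansion
  \<open>euler (euler f)\<close> contributes the Hessian form \<open>Q\<close> and half the double
  sum contributes \<open>- Q\<close>, so it cancels.\<close>

lemma laplacian_euler_angular:
  fixes f :: "real ^ 'n::finite \<Rightarrow> real"
  assumes "smooth f"
  shows "(norm x)\<^sup>2 * laplacian f x = euler (euler f) x + (real CARD('n) - 2) * euler f x
    + 1 / 2 * (\<Sum>i\<in>UNIV. \<Sum>j\<in>UNIV. angular i j (angular i j f) x)"
proof -
  define D where "D = (\<lambda>i. partial_deriv i f x)"
  define H where "H = (\<lambda>i j. partial_deriv i (partial_deriv j f) x)"
  define Q where "Q = (\<Sum>i\<in>UNIV. \<Sum>j\<in>UNIV. x $ i * (x $ j * H i j))"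
  have norm: "(norm x)\<^sup>2 = (\<Sum>i\<in>UNIV. x $ i * x $ i)"
    by (simp add: power2_norm_eq_inner inner_vec_def)
  have E: "euler f x = (\<Sum>i\<in>UNIV. x $ i * D i)"
    by (simp add: euler_def D_def)
  have EE: "euler (euler f) x = euler f x + Q"
    by (subst (1) euler_def, subst partial_deriv_euler[OF assms])
      (simp add: algebra_simps sum.distrib sum_distrib_left Q_def H_def E D_def)
  \<comment> \<open>On the diagonal the left side is 0; the two conditionals cancel the first-order
    terms there.\<close>
  have L: "angular i j (angular i j f) x =
      (if i = j then x $ i * D i else 0) + (if i = j then x $ i * D i else 0)
      + x $ i * x $ i * H j j + x $ j * x $ j * H i i
      - x $ i * D i - x $ j * D j - x $ i * (x $ j * H i j) - x $ j * (x $ i * H j i)" for i j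
    unfolding angular_def[of i j "angular i j f"] partial_deriv_angular[OF assms]
    using partial_deriv_commute[OF assms]
    by (auto simp: D_def H_def algebra_simps)
  have swap: "(\<Sum>i\<in>UNIV. \<Sum>j\<in>UNIV. x $ j * (x $ i * H j i)) = Q"
    unfolding Q_def by (rule sum.swap)
  have a: "(\<Sum>i\<in>UNIV. \<Sum>j\<in>UNIV. x $ i * x $ i * H j j) = (norm x)\<^sup>2 * laplacian f x"
    by (simp add: norm laplacian_def H_def sum_product)
  have b: "(\<Sum>i\<in>UNIV. \<Sum>j\<in>UNIV. x $ j * x $ j * H i i) = (norm x)\<^sup>2 * laplacian f x"
    by (subst sum.swap) (simp add: a)
  have "(\<Sum>i\<in>UNIV. \<Sum>j\<in>UNIV. angular i j (angular i j f) x) =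
      2 * euler f x + 2 * (norm x)\<^sup>2 * laplacian f x - 2 * CARD('n) * euler f x - 2 * Q"
    unfolding L sum.distrib sum_subtractf a b swap Q_def[symmetric]
    by (simp add: E sum_distrib_left[symmetric])
  then show ?thesis by (simp add: EE algebra_simps)
qed

lemma norm_grad_squared: "(norm (grad f x))\<^sup>2 = (\<Sum>i\<in>UNIV. (partial_deriv i f x)\<^sup>2)"
  unfolding power2_norm_eq_inner by (simp add: inner_vec_def grad_def power2_eq_square)

text \<open>Lagrange's identity for the vectors \<open>x\<close> and \<open>grad f x\<close>. The
  factor 2 appears because every pair of indices is counted in both orders.\<close>

lemma sum_angular_squares:
  "(\<Sum>i\<in>UNIV. \<Sum>j\<in>UNIV. (angular i j f x)\<^sup>2) = 2 * ((norm x)\<^sup>2 * (norm (grad f x))\<^sup>2 - (euler f x)\<^sup>2)"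
proof -
  define D where "D = (\<lambda>i. partial_deriv i f x)"
  have "(\<Sum>i\<in>UNIV. \<Sum>j\<in>UNIV. (angular i j f x)\<^sup>2)
      = (\<Sum>i\<in>UNIV. \<Sum>j\<in>UNIV. (x $ i * x $ i) * (D j * D j)) + (\<Sum>i\<in>UNIV. \<Sum>j\<in>UNIV. (D i * D i) * (x $ j * x $ j))
        - 2 * (\<Sum>i\<in>UNIV. \<Sum>j\<in>UNIV. (x $ i * D i) * (x $ j * D j))"
    by (simp add: angular_def D_def power2_eq_square algebra_simps sum.distrib sum_subtractf sum_distrib_left)
  also have "\<dots> = 2 * ((norm x)\<^sup>2 * (norm (grad f x))\<^sup>2 - (euler f x)\<^sup>2)"
    unfolding sum_product[symmetric] norm_grad_squared power2_norm_eq_inner[of x]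
    by (simp add: inner_vec_def euler_def D_def power2_eq_square)
  finally show ?thesis .
qed


subsection \<open>Integration by parts against radial weights\<close>

text \<open>\<open>U\<close> and the complement of \<open>K\<close> are open and cover the space,
  and \<open>h\<close> is continuous on each of them.\<close>

lemma continuous_on_extend_by_zero:
  fixes h :: "'a::topological_space \<Rightarrow> 'b::{zero,topological_space}"
  assumes "open U" "closed K" "K \<subseteq> U" "continuous_on U h" "\<And>x. x \<notin> K \<Longrightarrow> h x = 0"
  shows "continuous_on UNIV h"
proof -
  have "continuous_on (- K) h"
    using assms(5) by (subst continuous_on_cong[OF refl, of _ h "\<lambda>_. 0"]) auto
  then have "continuous_on (U \<union> - K) h"
    using assms by (intro continuous_on_open_Un) auto
  moreover have "U \<union> - K = UNIV" using assms(3) by blast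
  ultimately show ?thesis by simp
qed

lemma integrable_continuous_compact_support:
  fixes h :: "'a::euclidean_space \<Rightarrow> real"
  assumes "compact K" "continuous_on K h" "\<And>x. x \<notin> K \<Longrightarrow> h x = 0"
  shows "integrable lborel h"
proof -
  have "integrable lborel (\<lambda>x. indicator K x *\<^sub>R h x)"
    using assms borel_integrable_compact[of K h] by blast
  also have "(\<lambda>x. indicator K x *\<^sub>R h x) = h"
    using assms(3) by (intro ext) (auto simp: indicator_def)
  finally show ?thesis .
qed

lemma integral_lborel_translate:
  fixes F :: "'a::euclidean_space \<Rightarrow> real"
  assumes "F \<in> borel_measurable borel"
  shows "integral\<^sup>L lborel (\<lambda>x. F (x + c)) = integral\<^sup>L lborel F"
proof -
  have "integral\<^sup>L lborel F = integral\<^sup>L (distr lborel borel ((+) c)) F"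
    by (simp add: lborel_distr_plus)
  also have "\<dots> = integral\<^sup>L lborel (\<lambda>x. F (c + x))"
    using assms by (intro integral_distr) auto
  finally show ?thesis by (simp add: add.commute)
qed

text \<open>Lebesgue measure is translation invariant, so every difference quotient of
  \<open>F\<close> in direction \<open>e\<close> integrates to 0; dominated convergence carries this
  over to the derivative. Differentiability is asked on \<open>U\<close> alone because the radial
  weights are controlled only for 0 < |x| < R.\<close>

lemma integral_directional_derivative_eq_0:
  fixes F D :: "'a::euclidean_space \<Rightarrow> real"
  assumes U: "open U" and K: "compact K" "K \<subseteq> U"
    and F': "\<And>x. x \<in> U \<Longrightarrow> (F has_derivative F' x) (at x)"
    and D: "\<And>x. x \<in> U \<Longrightarrow> D x = F' x e"
    and contD: "continuous_on U D"
    and F0: "\<And>x. x \<notin> K \<Longrightarrow> F x = 0" and D0: "\<And>x. x \<notin> K \<Longrightarrow> D x = 0"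
  shows "integral\<^sup>L lborel D = 0"
proof -
  have contF: "continuous_on UNIV F"
  proof (rule continuous_on_extend_by_zero[OF U compact_imp_closed[OF K(1)] K(2) _ F0])
    show "continuous_on U F"
      using F' has_derivative_continuous by (intro continuous_at_imp_continuous_on) blast
  qed
  then have [measurable]: "F \<in> borel_measurable borel"
    by (rule borel_measurable_continuous_onI)
  have intF: "integrable lborel F"
    using integrable_continuous_compact_support[OF K(1) continuous_on_subset[OF contF] F0] by simp
  have contD': "continuous_on UNIV D"
    by (rule continuous_on_extend_by_zero[OF U compact_imp_closed[OF K(1)] K(2) contD D0])
  then have [measurable]: "D \<in> borel_measurable borel"
    by (rule borel_measurable_continuous_onI)
  \<comment> \<open>In \<open>U\<close> this is the chain rule; elsewhere the point lies off the
    closed set \<open>K\<close>, and \<open>F\<close> vanishes in a neighbourhood.\<close>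
  have line: "((\<lambda>t. F (x + t *\<^sub>R e)) has_real_derivative D (x + t *\<^sub>R e)) (at t)" for x t
  proof (cases "x + t *\<^sub>R e \<in> U")
    case True
    interpret bounded_linear "F' (x + t *\<^sub>R e)"
      using F'[OF True] by (rule has_derivative_bounded_linear)
    have "((\<lambda>t. F (x + t *\<^sub>R e)) has_derivative (\<lambda>h. F' (x + t *\<^sub>R e) (h *\<^sub>R e))) (at t)"
      by (rule has_derivative_compose[where f = "\<lambda>t. x + t *\<^sub>R e"])
        (auto intro!: derivative_eq_intros F' True)
    moreover have "(\<lambda>h. F' (x + t *\<^sub>R e) (h *\<^sub>R e)) = (*) (D (x + t *\<^sub>R e))"
      by (rule ext) (simp add: scaleR D[OF True])
    ultimately show ?thesis by (simp add: has_field_derivative_def)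
  next
    case False
    let ?S = "(\<lambda>t. x + t *\<^sub>R e) -` (- K)"
    have "open ?S"
      by (intro continuous_open_vimage) (auto intro!: continuous_intros open_Compl compact_imp_closed K)
    moreover have "t \<in> ?S" using False K by auto
    ultimately have "((\<lambda>t. F (x + t *\<^sub>R e)) has_real_derivative 0) (at t)"
      by (rule has_field_derivative_transform_within_open[OF DERIV_const]) (simp add: F0)
    moreover have "D (x + t *\<^sub>R e) = 0" using False K by (intro D0) auto
    ultimately show ?thesis by simp
  qed
  obtain M where M: "\<And>x. \<bar>D x\<bar> \<le> M"
  proof -
    have "bounded (D ` K)"
      using K contD' by (intro compact_imp_bounded compact_continuous_image) (auto intro: continuous_on_subset)
    then obtain B where "B > 0" "\<And>x. x \<in> K \<Longrightarrow> \<bar>D x\<bar> \<le> B"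
      by (auto simp: bounded_pos)
    with D0 that[of B] show ?thesis by (metis abs_zero less_imp_le)
  qed
  obtain r where r: "K \<subseteq> cball 0 r"
    using compact_imp_bounded[OF K(1)] by (auto simp: bounded_iff subset_iff)
  define t where "t = (\<lambda>k. 1 / real (Suc k))"
  have t: "0 < t k" "t k \<le> 1" for k by (auto simp: t_def field_simps)
  have t0: "t \<longlonglongrightarrow> 0" unfolding t_def by (rule lim_1_over_n[THEN LIMSEQ_Suc])
  define q where "q = (\<lambda>k x. (F (x + t k *\<^sub>R e) - F x) / t k)"
  \<comment> \<open>The steps \<open>t k\<close> are at most 1, so all quotients vanish outside a
    ball enlarged by \<open>norm e\<close>, and the mean value theorem bounds them by
    \<open>M\<close>.\<close>
  let ?w = "\<lambda>x. M * indicator (cball 0 (r + norm e)) x"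
  have "(\<lambda>k. integral\<^sup>L lborel (q k)) \<longlonglongrightarrow> integral\<^sup>L lborel D"
  proof (rule integral_dominated_convergence[where w = ?w])
    show "integrable lborel ?w"
      using emeasure_bounded_finite[OF bounded_cball]
      by (intro integrable_mult_right integrable_real_indicator) auto
    show "AE x in lborel. (\<lambda>k. q k x) \<longlonglongrightarrow> D x"
    proof (intro AE_I2)
      fix x
      have "((\<lambda>h. (F (x + h *\<^sub>R e) - F x) / h) \<longlongrightarrow> D x) (at 0)"
        using line[of x 0] by (simp add: DERIV_def)
      moreover have "filterlim t (at 0) sequentially"
        using t0 t by (auto simp: filterlim_at less_le)
      ultimately show "(\<lambda>k. q k x) \<longlonglongrightarrow> D x"
        unfolding q_def by (rule filterlim_compose)
    qed
    show "AE x in lborel. norm (q k x) \<le> ?w x" for k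
    proof (intro AE_I2)
      fix x
      show "norm (q k x) \<le> ?w x"
      proof (cases "x \<in> cball 0 (r + norm e)")
        case True
        obtain z where "F (x + t k *\<^sub>R e) - F (x + 0 *\<^sub>R e) = (t k - 0) * D (x + z *\<^sub>R e)"
          using MVT2[OF t(1)[of k] line[of x]] by auto
        then have "q k x = D (x + z *\<^sub>R e)" using t(1)[of k] by (simp add: q_def)
        with M[of "x + z *\<^sub>R e"] True show ?thesis by simp
      next
        case False
        have "norm (x + t k *\<^sub>R e) \<ge> norm x - norm e"
        proof -
          have "norm (t k *\<^sub>R e) \<le> norm e"
            using t[of k] by (simp add: mult_left_le_one_le)
          then show ?thesis using norm_diff_ineq[of x "t k *\<^sub>R e"] by linarith
        qed
        moreover have "norm y \<le> r" if "y \<in> K" for y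
          using r that by auto
        moreover have "r + norm e < norm x" using False by simp
        ultimately have "x \<notin> K" "x + t k *\<^sub>R e \<notin> K"
          using norm_ge_zero[of e] by (meson add_increasing2 leD order_trans, smt (verit))
        then show ?thesis using False F0 by (simp add: q_def)
      qed
    qed
  qed (auto simp: q_def)
  moreover have "integral\<^sup>L lborel (q k) = 0" for k
  proof -
    have "integrable lborel (\<lambda>x. F (x + t k *\<^sub>R e))"
    proof (rule integrable_continuous_compact_support)
      show "compact ((\<lambda>x. x - t k *\<^sub>R e) ` K)"
        by (intro compact_continuous_image K continuous_intros)
      show "continuous_on ((\<lambda>x. x - t k *\<^sub>R e) ` K) (\<lambda>x. F (x + t k *\<^sub>R e))"
        by (intro continuous_on_compose2[OF contF] continuous_intros) auto
      fix x assume "x \<notin> (\<lambda>x. x - t k *\<^sub>R e) ` K"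
      then show "F (x + t k *\<^sub>R e) = 0"
        by (intro F0) (force intro: image_eqI[of _ _ "x + t k *\<^sub>R e"])
    qed
    then show ?thesis
      unfolding q_def using intF integral_lborel_translate[of F "t k *\<^sub>R e"]
      by (subst integral_divide_zero, subst Bochner_Integration.integral_diff) auto
  qed
  ultimately have "(\<lambda>k. 0) \<longlonglongrightarrow> integral\<^sup>L lborel D" by simp
  then show ?thesis by (simp add: LIMSEQ_const_iff)
qed

text \<open>The strict inequality describes an open set, so partial derivatives vanish on the same
  set and \<open>b\<close> need not be enlarged.\<close>

definition vanishes_beyond :: "real \<Rightarrow> (real ^ 'n::finite \<Rightarrow> real) \<Rightarrow> bool" where
  "vanishes_beyond b f \<longleftrightarrow> (\<forall>x. b < norm x \<longrightarrow> f x = 0)"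

lemma vanishes_beyond_partial_deriv:
  assumes "vanishes_beyond b f"
  shows "vanishes_beyond b (partial_deriv i f)"
  unfolding vanishes_beyond_def
proof (intro allI impI)
  fix x :: "real ^ 'a" assume "b < norm x"
  moreover have "open (- cball (0::real^'a) b)" by (simp add: open_Compl)
  ultimately have "(f has_derivative (\<lambda>_. 0)) (at x)"
    using assms by (intro has_derivative_transform_within_open[OF has_derivative_const, of "- cball 0 b"])
      (auto simp: vanishes_beyond_def)
  from partial_deriv_eqI[OF this] show "partial_deriv i f x = 0" .
qed

lemma vanishes_beyond_euler: "vanishes_beyond b f \<Longrightarrow> vanishes_beyond b (euler f)"
  using vanishes_beyond_partial_deriv[of b f] by (fastforce simp: vanishes_beyond_def euler_def)

lemma vanishes_beyond_angular: "vanishes_beyond b f \<Longrightarrow> vanishes_beyond b (angular i j f)"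
  using vanishes_beyond_partial_deriv[of b f] by (fastforce simp: vanishes_beyond_def angular_def)

text \<open>Vanishing below \<open>a\<close> removes the singularity at the origin. No regularity is
  asked from \<open>R\<close> on; there the weights meet functions that vanish beyond some
  \<open>b < R\<close>.\<close>

definition radial_weight :: "real \<Rightarrow> real \<Rightarrow> (real \<Rightarrow> real) \<Rightarrow> (real \<Rightarrow> real) \<Rightarrow> bool" where
  "radial_weight a R G G' \<longleftrightarrow> 0 < a \<and> continuous_on {0<..<R} G' \<and>
    (\<forall>r\<in>{0<..<R}. (G has_real_derivative G' r) (at r)) \<and> (\<forall>r<a. G r = 0 \<and> G' r = 0)"

lemma radial_weight_continuous: "radial_weight a R G G' \<Longrightarrow> continuous_on {0<..<R} G"
  unfolding radial_weight_def by (meson DERIV_isCont continuous_at_imp_continuous_on)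

lemma compact_annulus: "compact {x :: real ^ 'n::finite. a \<le> norm x \<and> norm x \<le> b}"
proof -
  have "{x :: real ^ 'n. a \<le> norm x \<and> norm x \<le> b} = cball 0 b - ball 0 a" by auto
  then show ?thesis by (simp add: compact_diff)
qed

lemma integrable_radial:
  fixes f :: "real ^ 'n::finite \<Rightarrow> real"
  assumes "continuous_on {0<..<R} G" "0 < a" "\<And>r. r < a \<Longrightarrow> G r = 0" "b < R"
    and "continuous_on UNIV f" "vanishes_beyond b f"
  shows "integrable lborel (\<lambda>x. G (norm x) * f x)"
proof (rule integrable_continuous_compact_support[OF compact_annulus[of a b]])
  show "continuous_on {x. a \<le> norm x \<and> norm x \<le> b} (\<lambda>x. G (norm x) * f x)"
    using assms(2,4)
    by (intro continuous_intros continuous_on_compose2[OF assms(1)] continuous_on_subset[OF assms(5)]) auto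
qed (use assms in \<open>auto simp: vanishes_beyond_def not_le\<close>)

context
  fixes a b R :: real and G G' :: "real \<Rightarrow> real" and f :: "real ^ 'n::finite \<Rightarrow> real"
  assumes G: "radial_weight a R G G'" and b: "b < R"
    and f: "smooth f" "vanishes_beyond b f"
begin

text \<open>The integrand is the partial derivative in direction \<open>j\<close> of
  \<open>G (norm x) * (x $ i * f x)\<close>, which is supported in the annulus between the radii
  \<open>a\<close> and \<open>b\<close>. Antisymmetrising in the indices and taking the trace give
  the two rules that follow.\<close>

lemma integral_partial_deriv_radial:
  "integrable lborel (\<lambda>x. G' (norm x) * (x $ j / norm x) * (x $ i * f x)
      + G (norm x) * ((if i = j then f x else 0) + x $ i * partial_deriv j f x))" (is "integrable _ ?D")
  "integral\<^sup>L lborel (\<lambda>x. G' (norm x) * (x $ j / norm x) * (x $ i * f x)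
      + G (norm x) * ((if i = j then f x else 0) + x $ i * partial_deriv j f x)) = 0"
proof -
  let ?U = "{x :: real ^ 'n. 0 < norm x \<and> norm x < R}"
  let ?K = "{x :: real ^ 'n. a \<le> norm x \<and> norm x \<le> b}"
  let ?F = "\<lambda>x. G (norm x) * (x $ i * f x)"
  let ?F' = "\<lambda>x h. G (norm x) * (x $ i * (\<Sum>k\<in>UNIV. h $ k * partial_deriv k f x) + h $ i * f x)
    + G' (norm x) * (h \<bullet> sgn x) * (x $ i * f x)"
  have U: "open ?U"
    by (intro open_Collect_conj open_Collect_less continuous_intros)
  have K: "?K \<subseteq> ?U" using b G by (auto simp: radial_weight_def)
  have cont: "continuous_on ?U ?D"
  proof -
    have "continuous_on ?U (\<lambda>x. G (norm x))" "continuous_on ?U (\<lambda>x. G' (norm x))"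
      using radial_weight_continuous[OF G] G
      by (auto simp: radial_weight_def intro!: continuous_on_compose2[where f = norm] continuous_intros)
    moreover have "continuous_on ?U f" "continuous_on ?U (partial_deriv j f)"
      by (simp_all add: smooth_continuous f smooth_partial_deriv)
    ultimately show ?thesis
      by (cases "i = j") (simp_all, (intro continuous_intros; auto)+)
  qed
  have zero: "?D x = 0" "?F x = 0" if "x \<notin> ?K" for x
  proof -
    consider "norm x < a" | "b < norm x" using \<open>x \<notin> ?K\<close> by force
    then have "?D x = 0 \<and> ?F x = 0"
      using G f(2) vanishes_beyond_partial_deriv[OF f(2), of j]
      by cases (auto simp: radial_weight_def vanishes_beyond_def)
    then show "?D x = 0" "?F x = 0" by auto
  qed
  have der: "(?F has_derivative ?F' x) (at x)" if "x \<in> ?U" for x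
  proof -
    have nth: "((\<lambda>x. x $ i) has_derivative (\<lambda>h. h $ i)) (at x)"
      by (rule bounded_linear_imp_has_derivative[OF bounded_linear_vec_nth])
    have "(norm has_derivative (\<lambda>h. h \<bullet> sgn x)) (at x)"
      using that by (intro has_derivative_norm) auto
    moreover have "(G has_derivative (*) (G' (norm x))) (at (norm x))"
      using G that by (simp add: radial_weight_def has_field_derivative_def)
    ultimately have "((\<lambda>x. G (norm x)) has_derivative (\<lambda>h. G' (norm x) * (h \<bullet> sgn x))) (at x)"
      by (rule has_derivative_compose)
    then show ?thesis
      by (intro has_derivative_mult nth has_derivative_partial_deriv smooth_differentiable f)
  qed
  have D: "?D x = ?F' x (axis j 1)" if "x \<in> ?U" for x
  proof -
    have "(\<Sum>k\<in>UNIV. axis j 1 $ k * partial_deriv k f x) = partial_deriv j f x"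
      by (simp add: axis_def if_distrib[of "\<lambda>z. z * _"] cong: if_cong)
    moreover have "axis j 1 \<bullet> sgn x = x $ j / norm x"
      by (simp add: inner_axis' sgn_div_norm divide_inverse mult.commute)
    moreover have "axis j (1::real) $ i = (if i = j then 1 else 0)"
      by (simp add: axis_def)
    ultimately show ?thesis by (simp add: algebra_simps)
  qed
  show "integrable lborel ?D"
    by (rule integrable_continuous_compact_support[OF compact_annulus continuous_on_subset[OF cont K]])
      (use zero in blast)
  show "integral\<^sup>L lborel ?D = 0"
    by (rule integral_directional_derivative_eq_0[OF U compact_annulus K der D cont])
      (use zero in blast)+
qed

text \<open>Subtracting the two index orders cancels the terms with \<open>G'\<close>: rotations
  annihilate radial functions.\<close>

lemma integral_radial_angular: "integral\<^sup>L lborel (\<lambda>x. G (norm x) * angular i j f x) = 0"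
proof -
  let ?D = "\<lambda>i j x. G' (norm x) * (x $ j / norm x) * (x $ i * f x)
      + G (norm x) * ((if i = j then f x else 0) + x $ i * partial_deriv j f x)"
  have "integral\<^sup>L lborel (\<lambda>x. ?D i j x - ?D j i x) = 0"
    by (simp only: Bochner_Integration.integral_diff integral_partial_deriv_radial diff_self)
  moreover have "(\<lambda>x. ?D i j x - ?D j i x) = (\<lambda>x. G (norm x) * angular i j f x)"
    by (rule ext) (simp add: angular_def algebra_simps)
  ultimately show ?thesis by simp
qed

text \<open>Summing the diagonal cases yields the divergence of the field \<open>x\<close>
  multiplied by \<open>G (norm x) * f x\<close>.\<close>

lemma integral_radial_euler:
  "integral\<^sup>L lborel (\<lambda>x. G (norm x) * euler f x
     + (CARD('n) * G (norm x) + norm x * G' (norm x)) * f x) = 0"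
proof -
  let ?D = "\<lambda>i x. G' (norm x) * (x $ i / norm x) * (x $ i * f x)
      + G (norm x) * ((if i = i then f x else 0) + x $ i * partial_deriv i f x)"
  have "integral\<^sup>L lborel (\<lambda>x. \<Sum>i\<in>UNIV. ?D i x) = 0"
    by (subst Bochner_Integration.integral_sum)
      (simp_all only: integral_partial_deriv_radial sum.neutral_const)
  moreover have "(\<Sum>i\<in>UNIV. ?D i x) = G (norm x) * euler f x
     + (CARD('n) * G (norm x) + norm x * G' (norm x)) * f x" for x
  proof -
    have "(\<Sum>i\<in>UNIV. x $ i / norm x * x $ i) = norm x"
    proof -
      have "(\<Sum>i\<in>UNIV. x $ i / norm x * x $ i) = (norm x)\<^sup>2 / norm x"
        unfolding power2_norm_eq_inner by (simp add: inner_vec_def sum_divide_distrib)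
      then show ?thesis by (simp add: power2_eq_square)
    qed
    moreover have "(\<Sum>i\<in>UNIV. ?D i x) = G' (norm x) * f x * (\<Sum>i\<in>UNIV. x $ i / norm x * x $ i)
        + (CARD('n) * G (norm x) * f x + G (norm x) * euler f x)"
      by (simp add: sum.distrib sum_distrib_left euler_def algebra_simps)
    ultimately show ?thesis by (simp add: algebra_simps)
  qed
  ultimately show ?thesis by simp
qed

end


subsection \<open>Positive Bessel solutions and the Riccati equation\<close>

text \<open>Positivity forces \<open>r y' \<le> 0\<close>: the function \<open>r y'\<close> decreases, so a positive value would make
  \<open>y\<close> drop to \<open>-\<infinity>\<close> logarithmically at the origin.\<close>

lemma positive_bessel_solution_nonincreasing:
  fixes y y' y'' W :: "real \<Rightarrow> real"
  assumes y: "\<And>r. 0 < r \<Longrightarrow> r < R \<Longrightarrow> (y has_real_derivative y' r) (at r)"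
    and y': "\<And>r. 0 < r \<Longrightarrow> r < R \<Longrightarrow> (y' has_real_derivative y'' r) (at r)"
    and eq: "\<And>r. 0 < r \<Longrightarrow> r < R \<Longrightarrow> y'' r + 1 / r * y' r + c * W r * y r = 0"
    and pos: "\<And>r. 0 < r \<Longrightarrow> r < R \<Longrightarrow> y r > 0"
    and W: "\<And>r. 0 < r \<Longrightarrow> r < R \<Longrightarrow> W r \<ge> 0" "c \<ge> 0"
    and r: "0 < r" "r < R"
  shows "y' r \<le> 0"
proof (rule ccontr)
  assume "\<not> y' r \<le> 0"
  then have \<delta>: "r * y' r > 0" using r by simp
  define \<delta> where "\<delta> = r * y' r"
  \<comment> \<open>By the equation, \<open>t * y' t\<close> has derivative
    \<open>- (c * W t * y t * t)\<close>; it is nonincreasing, so to the left of \<open>r\<close> it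
    stays at least \<delta>.\<close>
  have z: "\<delta> \<le> t * y' t" if "0 < t" "t \<le> r" for t
    unfolding \<delta>_def
  proof (rule DERIV_nonpos_imp_nonincreasing[OF that(2)])
    fix x assume x: "t \<le> x" "x \<le> r"
    have "((\<lambda>t. t * y' t) has_real_derivative 1 * y' x + y'' x * x) (at x)"
      using x that r by (intro DERIV_mult DERIV_ident y') auto
    moreover have "1 * y' x + y'' x * x = - (c * W x * y x * x)"
      using eq[of x] x that r by (simp add: field_simps)
    moreover have "- (c * W x * y x * x) \<le> 0"
      using W(1)[of x] W(2) pos[of x] x that r by simp
    ultimately show "\<exists>y. ((\<lambda>t. t * y' t) has_real_derivative y) (at x) \<and> y \<le> 0" by metis
  qed
  have le: "y t - \<delta> * ln t \<le> y r - \<delta> * ln r" if "0 < t" "t \<le> r" for t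
  proof (rule DERIV_nonneg_imp_nondecreasing[OF that(2)])
    fix x assume x: "t \<le> x" "x \<le> r"
    have "((\<lambda>t. y t - \<delta> * ln t) has_real_derivative y' x - \<delta> * (1 / x)) (at x)"
      using x that r by (intro DERIV_diff y DERIV_cmult DERIV_ln_divide) auto
    moreover have "y' x - \<delta> * (1 / x) \<ge> 0"
      using z[of x] x that by (simp add: field_simps)
    ultimately show "\<exists>d. ((\<lambda>t. y t - \<delta> * ln t) has_real_derivative d) (at x) \<and> 0 \<le> d" by blast
  qed
  \<comment> \<open>The point at which the logarithmic upper bound \<open>le\<close> becomes exactly
    0.\<close>
  define t where "t = r * exp (- (y r / \<delta>))"
  have t: "0 < t" "t \<le> r"
    using r pos[OF r] \<delta> by (auto simp: t_def \<delta>_def[symmetric])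
  have "ln t = ln r - y r / \<delta>"
    using r by (simp add: t_def ln_mult)
  then have "\<delta> * ln t = \<delta> * ln r - y r"
    using \<delta> by (simp add: \<delta>_def[symmetric] right_diff_distrib)
  then have "y t \<le> 0"
    using le[OF t] by simp
  with pos[of t] t r show False by simp
qed

text \<open>Here \<open>V r\<close> stands for \<open>c * W r * r^2\<close>, and
  \<open>r * s' r\<close> is the Euler derivative of \<open>s\<close>. The sign of \<open>s\<close>
  is recorded because it makes the cutoff term of the Hardy inequality nonnegative.\<close>

definition riccati_solution :: "(real \<Rightarrow> real) \<Rightarrow> real \<Rightarrow> (real \<Rightarrow> real) \<Rightarrow> (real \<Rightarrow> real) \<Rightarrow> bool" where
  "riccati_solution V R s s' \<longleftrightarrow> continuous_on {0<..<R} V \<and> continuous_on {0<..<R} s' \<and> (\<forall>r\<in>{0<..<R}.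
    (s has_real_derivative s' r) (at r) \<and> 0 \<le> s r \<and> 0 \<le> V r \<and> r * s' r = V r + (s r)\<^sup>2)"

lemma bessel_riccati:
  assumes W: "continuous_on {0<..<R} W" "\<And>r. r \<in> {0<..<R} \<Longrightarrow> W r \<ge> 0" and "c \<ge> 0"
    and "has_positive_bessel_solution W R c"
  obtains s s' where "riccati_solution (\<lambda>r. c * W r * r\<^sup>2) R s s'"
proof -
  obtain y y' y'' where sol: "\<And>r. r \<in> {0<..<R} \<Longrightarrow> (y has_real_derivative y' r) (at r) \<and>
        (y' has_real_derivative y'' r) (at r) \<and>
        y'' r + 1 / r * y' r + c * W r * y r = 0 \<and> y r > 0"
    using assms(4) unfolding has_positive_bessel_solution_def by blast
  \<comment> \<open>Up to sign this is the logarithmic derivative of \<open>y\<close> with respect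
    to \<open>ln r\<close>, which turns the linear second-order equation into a Riccati
    equation.\<close>
  define s where "s = (\<lambda>r. - r * y' r / y r)"
  define s' where "s' = (\<lambda>r. c * W r * r + (s r)\<^sup>2 / r)"
  have s: "(s has_real_derivative s' r) (at r)" if r: "r \<in> {0<..<R}" for r
  proof -
    have "(s has_real_derivative ((- 1 * y' r + y'' r * - r) * y r - - r * y' r * y' r) / (y r * y r)) (at r)"
      unfolding s_def using sol[OF r]
      by (intro DERIV_divide DERIV_mult DERIV_minus DERIV_ident) auto
    moreover have "((- 1 * y' r + y'' r * - r) * y r - - r * y' r * y' r) / (y r * y r) = s' r"
    proof -
      have "- 1 * y' r + y'' r * - r = c * W r * r * y r"
        using sol[OF r] r by (simp add: field_simps)
      then show ?thesis using sol[OF r] r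
        by (simp add: s'_def s_def field_simps power2_eq_square)
    qed
    ultimately show ?thesis by simp
  qed
  have "continuous_on {0<..<R} s"
    using s by (meson DERIV_isCont continuous_at_imp_continuous_on)
  then have "continuous_on {0<..<R} s'"
    unfolding s'_def by (intro continuous_intros W) auto
  moreover have "0 \<le> s r" if r: "r \<in> {0<..<R}" for r
  proof -
    have "y' r \<le> 0"
      using positive_bessel_solution_nonincreasing[of R y y' y'' c W r] sol W assms(3) r by auto
    then show ?thesis using sol[OF r] r by (simp add: s_def divide_le_0_iff mult_le_0_iff)
  qed
  ultimately have "riccati_solution (\<lambda>r. c * W r * r\<^sup>2) R s s'"
    unfolding riccati_solution_def using s W assms(3)
    by (auto simp: s'_def power2_eq_square algebra_simps intro!: continuous_intros)
  then show ?thesis by (rule that)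
qed

lemma radial_weight_mult:
  assumes "radial_weight a R G G'" "\<And>r. r \<in> {0<..<R} \<Longrightarrow> (s has_real_derivative s' r) (at r)"
    and "continuous_on {0<..<R} s'"
  shows "radial_weight a R (\<lambda>r. G r * s r) (\<lambda>r. G' r * s r + s' r * G r)"
proof -
  have "continuous_on {0<..<R} s"
    using assms(2) by (meson DERIV_isCont continuous_at_imp_continuous_on)
  with assms show ?thesis
    using radial_weight_continuous[OF assms(1)]
    by (auto simp: radial_weight_def intro!: continuous_intros DERIV_mult)
qed

lemma radial_weight_powr:
  assumes "radial_weight a R G G'"
  shows "radial_weight a R (\<lambda>r. G r * r powr p) (\<lambda>r. G' r * r powr p + p * r powr (p - 1) * G r)"
  using assms
  by (rule radial_weight_mult) (auto intro!: has_real_derivative_powr continuous_intros)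

subsection \<open>The inequality with cut off weights\<close>

text \<open>The bounds on q = 2 m + 4 express the hypotheses on m, and \<open>dim\<close> supplies
  the dimension to them. The sign of \<open>\<phi>'\<close> is what makes the cutoff terms
  favourable in the Hardy inequality.\<close>

locale cutoff_weight =
  fixes a b R q :: real and \<phi> \<phi>' :: "real \<Rightarrow> real" and dim :: "'n::finite itself"
  assumes \<phi>: "radial_weight a R \<phi> \<phi>'" and \<phi>_nonneg: "\<And>r. 0 \<le> \<phi> r" "\<And>r. 0 \<le> \<phi>' r"
    and b: "b < R" and q: "2 \<le> q" "q \<le> CARD('n)"
begin

definition P :: "real \<Rightarrow> real" where "P r = \<phi> r * r powr (- q)"
text \<open>Not the derivative of \<open>P\<close>: for positive \<open>r\<close> it is the part of
  \<open>r\<close> times that derivative in which the cutoff is differentiated. The other part is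
  \<open>- q * P r\<close>.\<close>

definition P' :: "real \<Rightarrow> real" where "P' r = r * \<phi>' r * r powr (- q)"

definition J :: "(real ^ 'n \<Rightarrow> real) \<Rightarrow> real" where
  "J h = integral\<^sup>L lborel (\<lambda>x. P (norm x) * h x)"

definition J' :: "(real ^ 'n \<Rightarrow> real) \<Rightarrow> real" where
  "J' h = integral\<^sup>L lborel (\<lambda>x. P' (norm x) * h x)"

definition adm :: "(real ^ 'n \<Rightarrow> real) \<Rightarrow> bool" where
  "adm f \<longleftrightarrow> smooth f \<and> vanishes_beyond b f"

lemma a_pos: "0 < a"
  using \<phi> by (simp add: radial_weight_def)

lemma P_weight: "radial_weight a R P (\<lambda>r. \<phi>' r * r powr (- q) + (- q) * r powr (- q - 1) * \<phi> r)"
  unfolding P_def[abs_def] by (rule radial_weight_powr[OF \<phi>])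

lemma P_nonneg: "0 \<le> P r" "0 \<le> r \<Longrightarrow> 0 \<le> P' r"
  by (simp_all add: P_def P'_def \<phi>_nonneg)

lemma P_zero: "r < a \<Longrightarrow> P r = 0" "r < a \<Longrightarrow> P' r = 0"
  using \<phi> by (simp_all add: P_def P'_def radial_weight_def)

lemma P_continuous: "continuous_on {0<..<R} P" "continuous_on {0<..<R} P'"
  using radial_weight_continuous[OF P_weight] \<phi>
  by (auto simp: P'_def[abs_def] radial_weight_def intro!: continuous_intros)

lemma adm_mult: "adm f \<Longrightarrow> adm g \<Longrightarrow> adm (\<lambda>x. f x * g x)"
  and adm_add: "adm f \<Longrightarrow> adm g \<Longrightarrow> adm (\<lambda>x. f x + g x)"
  and adm_diff: "adm f \<Longrightarrow> adm g \<Longrightarrow> adm (\<lambda>x. f x - g x)"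
  and adm_cmult: "adm f \<Longrightarrow> adm (\<lambda>x. c * f x)"
  and adm_euler: "adm f \<Longrightarrow> adm (euler f)"
  and adm_angular: "adm f \<Longrightarrow> adm (angular i j f)"
  and adm_sum: "(\<And>k. k \<in> I \<Longrightarrow> adm (F k)) \<Longrightarrow> adm (\<lambda>x. \<Sum>k\<in>I. F k x)"
  by (auto simp: adm_def smooth_mult smooth_add smooth_diff smooth_const smooth_euler smooth_angular
      vanishes_beyond_euler vanishes_beyond_angular smooth_sum)
    (auto simp: vanishes_beyond_def)

lemma adm_square: "adm f \<Longrightarrow> adm (\<lambda>x. (f x)\<^sup>2)"
  using adm_mult[of f f] by (simp add: power2_eq_square)

lemmas adm_intros = adm_mult adm_add adm_diff adm_cmult adm_euler adm_angular adm_sum adm_square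

text \<open>\<open>V\<close> may be singular at 0 and at \<open>R\<close>, but \<open>P\<close> and
  \<open>P'\<close> vanish near the origin and \<open>h\<close> vanishes beyond
  \<open>b < R\<close>.\<close>

lemma integrable_weighted:
  assumes "continuous_on {0<..<R} V" "adm h"
  shows "integrable lborel (\<lambda>x. P (norm x) * V (norm x) * h x)"
    and "integrable lborel (\<lambda>x. P' (norm x) * V (norm x) * h x)"
  using assms P_zero
  by (auto intro!: integrable_radial[OF _ a_pos _ b] continuous_intros P_continuous
      simp: adm_def smooth_continuous)

lemma integrable_P:
  assumes "adm h"
  shows "integrable lborel (\<lambda>x. P (norm x) * h x)" "integrable lborel (\<lambda>x. P' (norm x) * h x)"
  using integrable_weighted[of "\<lambda>_. 1", OF continuous_on_const assms] by simp_all

lemma J_add: "adm f \<Longrightarrow> adm g \<Longrightarrow> J (\<lambda>x. f x + g x) = J f + J g"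
  by (simp add: J_def distrib_left integrable_P)

lemma J_cmult: "J (\<lambda>x. c * f x) = c * J f"
  unfolding J_def by (subst integral_mult_right_zero[symmetric]) (simp add: mult.left_commute)

lemma J_sum: "(\<And>k. k \<in> I \<Longrightarrow> adm (F k)) \<Longrightarrow> J (\<lambda>x. \<Sum>k\<in>I. F k x) = (\<Sum>k\<in>I. J (F k))"
  by (simp add: J_def sum_distrib_left integrable_P)

lemma J_nonneg: "(\<And>x. 0 \<le> f x) \<Longrightarrow> 0 \<le> J f" "(\<And>x. 0 \<le> f x) \<Longrightarrow> 0 \<le> J' f"
  unfolding J_def J'_def by (auto intro!: integral_nonneg_AE simp: P_nonneg)

lemma J_mono: "adm f \<Longrightarrow> adm g \<Longrightarrow> (\<And>x. f x \<le> g x) \<Longrightarrow> J f \<le> J g"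
  unfolding J_def by (auto intro!: integral_mono simp: integrable_P mult_left_mono P_nonneg)

text \<open>The divergence of the field \<open>x\<close> contributes the dimension, and the Euler
  derivative of the weight contributes \<open>- q * P + P'\<close>.\<close>

lemma J_euler:
  assumes "adm f"
  shows "J (euler f) = - (CARD('n) - q) * J f - J' f"
proof -
  let ?G' = "\<lambda>r. \<phi>' r * r powr (- q) + (- q) * r powr (- q - 1) * \<phi> r"
  have key: "norm x * ?G' (norm x) = P' (norm x) - q * P (norm x)" for x :: "real ^ 'n"
    by (cases "x = 0") (simp_all add: P_def P'_def powr_diff field_simps)
  have "P (norm x) * euler f x + (CARD('n) * P (norm x) + norm x * ?G' (norm x)) * f x
      = P (norm x) * euler f x + ((CARD('n) - q) * (P (norm x) * f x) + P' (norm x) * f x)" for x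
    unfolding key by (simp add: algebra_simps)
  then have "integral\<^sup>L lborel (\<lambda>x. P (norm x) * euler f x
      + ((CARD('n) - q) * (P (norm x) * f x) + P' (norm x) * f x)) = 0"
    using integral_radial_euler[OF P_weight b, of f] assms by (simp add: adm_def)
  then have "J (euler f) + ((CARD('n) - q) * J f + J' f) = 0"
    using assms by (simp add: J_def J'_def integrable_P adm_euler)
  then show ?thesis by (simp add: algebra_simps)
qed

lemma J_angular: "adm f \<Longrightarrow> J (angular i j f) = 0"
  unfolding J_def adm_def by (blast intro: integral_radial_angular[OF P_weight b])

lemma J_mult_euler:
  assumes "adm f"
  shows "J (\<lambda>x. f x * euler f x) = - (CARD('n) - q) / 2 * J (\<lambda>x. (f x)\<^sup>2) - J' (\<lambda>x. (f x)\<^sup>2) / 2"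
proof -
  have "euler (\<lambda>x. (f x)\<^sup>2) = (\<lambda>x. 2 * (f x * euler f x))"
    unfolding power2_eq_square using assms by (auto simp: euler_mult adm_def)
  then have "2 * J (\<lambda>x. f x * euler f x) = J (euler (\<lambda>x. (f x)\<^sup>2))"
    by (simp add: J_cmult)
  also have "\<dots> = - (CARD('n) - q) * J (\<lambda>x. (f x)\<^sup>2) - J' (\<lambda>x. (f x)\<^sup>2)"
    by (rule J_euler[OF adm_square[OF assms]])
  finally show ?thesis by (simp add: field_simps)
qed

text \<open>The cross term of the nonnegative square is a multiple of the Euler derivative of f^2,
  which is integrated by parts against the weight \<open>P * (\<gamma> + s)\<close>. The Riccati
  equation then turns the derivative of \<open>s\<close> into V + s^2.\<close>

lemma hardy:
  assumes s: "riccati_solution V R s s'" and f: "adm f"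
  shows "J (\<lambda>x. (euler f x)\<^sup>2) \<ge> ((CARD('n) - q) / 2)\<^sup>2 * J (\<lambda>x. (f x)\<^sup>2)
    + integral\<^sup>L lborel (\<lambda>x. P (norm x) * V (norm x) * (f x)\<^sup>2)"
proof -
  define \<gamma> where "\<gamma> = (CARD('n) - q) / 2"
  have \<gamma>: "0 \<le> \<gamma>" using q by (simp add: \<gamma>_def)
  have ds: "((\<lambda>r. \<gamma> + s r) has_real_derivative s' r) (at r)" if "r \<in> {0<..<R}" for r
    using s that by (auto simp: riccati_solution_def intro!: derivative_eq_intros)
  have V: "continuous_on {0<..<R} V" and s': "continuous_on {0<..<R} s'"
    using s by (auto simp: riccati_solution_def)
  let ?G' = "\<lambda>r. \<phi>' r * r powr (- q) + (- q) * r powr (- q - 1) * \<phi> r"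
  let ?H = "\<lambda>r. P r * (\<gamma> + s r)" and ?H' = "\<lambda>r. ?G' r * (\<gamma> + s r) + s' r * P r"
  have H: "radial_weight a R ?H ?H'"
    by (rule radial_weight_mult[OF P_weight ds s'])
  \<comment> \<open>An exact divergence, with integral 0; adding it reduces the inequality to the
    pointwise comparison \<open>le\<close>.\<close>
  let ?Z = "\<lambda>x. ?H (norm x) * euler (\<lambda>x. (f x)\<^sup>2) x
      + (CARD('n) * ?H (norm x) + norm x * ?H' (norm x)) * (f x)\<^sup>2"
  let ?A = "\<lambda>x. P (norm x) * (euler f x)\<^sup>2"
  let ?B = "\<lambda>x. \<gamma>\<^sup>2 * (P (norm x) * (f x)\<^sup>2) + P (norm x) * V (norm x) * (f x)\<^sup>2"
  have E: "euler (\<lambda>x. (f x)\<^sup>2) x = 2 * f x * euler f x" for x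
    unfolding power2_eq_square using f by (simp add: euler_mult adm_def)
  have Z0: "integral\<^sup>L lborel ?Z = 0"
    using integral_radial_euler[OF H b, of "\<lambda>x. (f x)\<^sup>2"] adm_square[OF f] by (simp add: adm_def)
  have le: "?B x - ?Z x \<le> ?A x" for x
  \<comment> \<open>At all other radii nothing is known about \<open>s\<close>; there
    \<open>P\<close> vanishes, or \<open>f\<close> does together with its Euler derivative.\<close>
  proof (cases "0 < norm x \<and> norm x < R")
    case False
    then have "norm x = 0 \<or> b < norm x" using b by auto
    then show ?thesis
    proof
      assume "norm x = 0"
      then show ?thesis using P_zero(1)[OF a_pos] by simp
    next
      assume "b < norm x"
      then have "f x = 0" "euler f x = 0"
        using f adm_euler[OF f] by (auto simp: adm_def vanishes_beyond_def)
      then show ?thesis by (simp add: E)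
    qed
  next
    case True
    define r where "r = norm x"
    have r: "0 < r" "r \<in> {0<..<R}" using True by (auto simp: r_def)
    have s_r: "0 \<le> s r" "r * s' r = V r + (s r)\<^sup>2"
      using s r by (auto simp: riccati_solution_def)
    have "r * ?G' r = P' r - q * P r"
      using r by (simp add: P_def P'_def powr_diff field_simps)
    moreover have "r * ?H' r = r * ?G' r * (\<gamma> + s r) + P r * (r * s' r)"
      by (simp add: algebra_simps)
    ultimately have H'_r: "r * ?H' r = (P' r - q * P r) * (\<gamma> + s r) + P r * (V r + (s r)\<^sup>2)"
      by (simp only: s_r)
    have "?A x - (?B x - ?Z x) = P r * (euler f x + (\<gamma> + s r) * f x)\<^sup>2
        + (CARD('n) - q - 2 * \<gamma>) * (P r * (\<gamma> + s r) * (f x)\<^sup>2) + P' r * (\<gamma> + s r) * (f x)\<^sup>2"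
      unfolding E r_def[symmetric] H'_r by (simp add: power2_eq_square algebra_simps)
    \<comment> \<open>The choice of \<gamma> makes the factor
      \<open>CARD('n) - q - 2 * \<gamma>\<close> vanish.\<close>
    also have "\<dots> = P r * (euler f x + (\<gamma> + s r) * f x)\<^sup>2 + P' r * (\<gamma> + s r) * (f x)\<^sup>2"
      by (simp add: \<gamma>_def)
    also have "\<dots> \<ge> 0"
      using P_nonneg[of r] r \<gamma> s_r by simp
    finally show ?thesis by simp
  qed
  have iZ: "integrable lborel ?Z"
  proof -
    have "integrable lborel (\<lambda>x. ?H (norm x) * euler (\<lambda>x. (f x)\<^sup>2) x)"
      using H adm_euler[OF adm_square[OF f]] a_pos b
      by (intro integrable_radial[OF radial_weight_continuous[OF H], of a])
        (auto simp: radial_weight_def adm_def smooth_continuous)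
    moreover have "integrable lborel (\<lambda>x. (CARD('n) * ?H (norm x) + norm x * ?H' (norm x)) * (f x)\<^sup>2)"
      using H adm_square[OF f] a_pos b
      by (intro integrable_radial[of R "\<lambda>r. CARD('n) * ?H r + r * ?H' r" a])
        (auto simp: radial_weight_def adm_def smooth_continuous intro!: continuous_intros radial_weight_continuous[OF H])
    ultimately show ?thesis by (rule Bochner_Integration.integrable_add)
  qed
  have iB: "integrable lborel (\<lambda>x. \<gamma>\<^sup>2 * (P (norm x) * (f x)\<^sup>2))"
      "integrable lborel (\<lambda>x. P (norm x) * V (norm x) * (f x)\<^sup>2)"
    by (intro integrable_mult_right integrable_P integrable_weighted V adm_square f)+
  have "integral\<^sup>L lborel (\<lambda>x. ?B x - ?Z x) \<le> integral\<^sup>L lborel ?A"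
    by (intro integral_mono le Bochner_Integration.integrable_diff Bochner_Integration.integrable_add iB iZ
        integrable_P adm_intros f)
  moreover have "integral\<^sup>L lborel (\<lambda>x. ?B x - ?Z x) = integral\<^sup>L lborel ?B - integral\<^sup>L lborel ?Z"
    by (intro Bochner_Integration.integral_diff Bochner_Integration.integrable_add iB iZ)
  moreover have "integral\<^sup>L lborel ?B = \<gamma>\<^sup>2 * J (\<lambda>x. (f x)\<^sup>2)
    + integral\<^sup>L lborel (\<lambda>x. P (norm x) * V (norm x) * (f x)\<^sup>2)"
    unfolding J_def by (simp only: Bochner_Integration.integral_add[OF iB] integral_mult_right_zero)
  ultimately show ?thesis
    unfolding J_def Z0 by (simp add: \<gamma>_def)
qed

lemma angular_add_cmult:
  assumes "smooth f" "smooth g"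
  shows "angular i j (\<lambda>x. f x + c * g x) x = angular i j f x + c * angular i j g x"
  using assms
  by (simp add: angular_def partial_deriv_add partial_deriv_mult smooth_differentiable smooth_mult
      smooth_const algebra_simps)

lemma J_mult_euler_euler:
  assumes "adm f"
  shows "J (\<lambda>x. f x * euler (euler f) x) =
    - (CARD('n) - q) * J (\<lambda>x. f x * euler f x) - J' (\<lambda>x. f x * euler f x) - J (\<lambda>x. (euler f x)\<^sup>2)"
proof -
  have "euler (\<lambda>x. f x * euler f x) = (\<lambda>x. (euler f x)\<^sup>2 + f x * euler (euler f) x)"
    using assms by (auto simp: euler_mult adm_def smooth_euler power2_eq_square)
  then have "J (euler (\<lambda>x. f x * euler f x)) = J (\<lambda>x. (euler f x)\<^sup>2) + J (\<lambda>x. f x * euler (euler f) x)"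
    using assms by (simp add: J_add adm_intros)
  then show ?thesis
    using J_euler[of "\<lambda>x. f x * euler f x"] assms by (simp add: adm_intros)
qed

text \<open>One \<open>angular i j\<close> is moved from \<open>w\<close> to the factor in front. It
  is skew-adjoint and commutes with \<open>euler\<close>, so that factor becomes minus the same
  radial operator applied to \<open>w\<close>. Integrating by parts in the Euler direction leaves
  squares with nonnegative coefficients and cutoff terms.\<close>

lemma J_angular_parts:
  fixes u :: "real ^ 'n \<Rightarrow> real" and i j :: 'n
  assumes u: "adm u"
  defines "w \<equiv> angular i j u"
  shows "J (\<lambda>x. (euler (euler u) x + (real CARD('n) - 2) * euler u x) * angular i j w x) =
    J (\<lambda>x. (euler w x)\<^sup>2) + (q - 2) * (CARD('n) - q) / 2 * J (\<lambda>x. (w x)\<^sup>2)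
    + (q - 2) / 2 * J' (\<lambda>x. (w x)\<^sup>2) + J' (\<lambda>x. w x * euler w x)"
proof -
  let ?\<alpha> = "real CARD('n) - 2"
  define g where "g = (\<lambda>x. euler (euler u) x + ?\<alpha> * euler u x)"
  have w: "adm w" and g: "adm g" using u by (simp_all add: w_def g_def adm_intros)
  have Ew: "euler w = angular i j (euler u)"
    using u by (auto simp: w_def angular_euler_commute adm_def)
  have EEw: "euler (euler w) = angular i j (euler (euler u))"
    unfolding Ew using u by (intro ext angular_euler_commute[symmetric] smooth_euler) (simp add: adm_def)
  have "angular i j (\<lambda>x. g x * w x) = (\<lambda>x. (w x * euler (euler w) x + ?\<alpha> * (w x * euler w x)) + g x * angular i j w x)"
  proof
    fix x
    have Lg: "angular i j g x = euler (euler w) x + ?\<alpha> * euler w x"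
      unfolding g_def EEw unfolding Ew using u by (simp add: angular_add_cmult adm_def smooth_euler)
    have "angular i j (\<lambda>x. g x * w x) x = angular i j g x * w x + g x * angular i j w x"
      using w g by (simp add: angular_mult adm_def)
    then show "angular i j (\<lambda>x. g x * w x) x
        = (w x * euler (euler w) x + ?\<alpha> * (w x * euler w x)) + g x * angular i j w x"
      unfolding Lg by (simp add: algebra_simps)
  qed
  then have "J (angular i j (\<lambda>x. g x * w x)) = J (\<lambda>x. w x * euler (euler w) x)
      + ?\<alpha> * J (\<lambda>x. w x * euler w x) + J (\<lambda>x. g x * angular i j w x)"
    using w g by (simp add: J_add J_cmult adm_intros)
  moreover have "J (angular i j (\<lambda>x. g x * w x)) = 0"
    by (intro J_angular adm_intros w g)
  ultimately have "J (\<lambda>x. g x * angular i j w x) = J (\<lambda>x. (euler w x)\<^sup>2)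
      + (2 - q) * J (\<lambda>x. w x * euler w x) + J' (\<lambda>x. w x * euler w x)"
    using J_mult_euler_euler[OF w] by (simp add: algebra_simps)
  then show ?thesis
    unfolding g_def J_mult_euler[OF w] by (simp add: field_simps)
qed

text \<open>The Laplacian splits into the radial part \<open>g\<close> and half the angular part
  \<open>S\<close>. The square of \<open>g\<close> is expanded directly, the product
  \<open>g * S\<close> by \<open>J_angular_parts\<close>, and the square of \<open>S\<close> is
  dropped. The \<open>J'\<close> terms on the right are kept as errors that vanish with the cutoff
  radius.\<close>

lemma laplacian_lower_bound:
  fixes u :: "real ^ 'n \<Rightarrow> real"
  assumes u: "adm u"
  shows "J (\<lambda>x. (euler (euler u) x)\<^sup>2)
      + ((real CARD('n) - 2)\<^sup>2 - (real CARD('n) - 2) * (CARD('n) - q)) * J (\<lambda>x. (euler u x)\<^sup>2)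
      + (\<Sum>i\<in>UNIV. \<Sum>j\<in>UNIV. J (\<lambda>x. (euler (angular i j u) x)\<^sup>2))
    \<le> J (\<lambda>x. ((norm x)\<^sup>2 * laplacian u x)\<^sup>2) + (real CARD('n) - 2) * J' (\<lambda>x. (euler u x)\<^sup>2)
      - (\<Sum>i\<in>UNIV. \<Sum>j\<in>UNIV. J' (\<lambda>x. angular i j u x * euler (angular i j u) x))"
proof -
  let ?\<alpha> = "real CARD('n) - 2"
  define e where "e = euler u"
  define S where "S = (\<lambda>x. \<Sum>i\<in>UNIV. \<Sum>j\<in>UNIV. angular i j (angular i j u) x)"
  define g where "g = (\<lambda>x. euler e x + ?\<alpha> * e x)"
  have e: "adm e" and g: "adm g" and S: "adm S"
    using u by (simp_all add: e_def g_def S_def adm_intros)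
  have lap: "(norm x)\<^sup>2 * laplacian u x = g x + 1 / 2 * S x" for x
    using u by (auto simp: laplacian_euler_angular g_def e_def S_def adm_def)
  have "J (\<lambda>x. (g x)\<^sup>2 + g x * S x) \<le> J (\<lambda>x. ((norm x)\<^sup>2 * laplacian u x)\<^sup>2)"
    unfolding lap
  proof (rule J_mono)
    show "(g x)\<^sup>2 + g x * S x \<le> (g x + 1 / 2 * S x)\<^sup>2" for x
      by (simp add: power2_eq_square algebra_simps)
  qed (intro adm_intros g S)+
  also have "J (\<lambda>x. (g x)\<^sup>2 + g x * S x) = J (\<lambda>x. (g x)\<^sup>2) + J (\<lambda>x. g x * S x)"
    by (intro J_add adm_intros g S)
  also have "(\<lambda>x. (g x)\<^sup>2) = (\<lambda>x. (euler e x)\<^sup>2 + ((2 * ?\<alpha>) * (e x * euler e x) + ?\<alpha>\<^sup>2 * (e x)\<^sup>2))"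
    by (auto simp: g_def power2_eq_square algebra_simps)
  also have "J \<dots> = J (\<lambda>x. (euler e x)\<^sup>2) + ((2 * ?\<alpha>) * J (\<lambda>x. e x * euler e x) + ?\<alpha>\<^sup>2 * J (\<lambda>x. (e x)\<^sup>2))"
    using e by (simp only: J_add J_cmult adm_intros)
  also have "J (\<lambda>x. g x * S x) = (\<Sum>i\<in>UNIV. \<Sum>j\<in>UNIV. J (\<lambda>x. g x * angular i j (angular i j u) x))"
    using u g by (simp only: S_def sum_distrib_left J_sum adm_intros)
  finally have "J (\<lambda>x. (euler e x)\<^sup>2) + ((2 * ?\<alpha>) * J (\<lambda>x. e x * euler e x) + ?\<alpha>\<^sup>2 * J (\<lambda>x. (e x)\<^sup>2))
      + (\<Sum>i\<in>UNIV. \<Sum>j\<in>UNIV. J (\<lambda>x. g x * angular i j (angular i j u) x))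
    \<le> J (\<lambda>x. ((norm x)\<^sup>2 * laplacian u x)\<^sup>2)" .
  moreover have "(\<Sum>i\<in>UNIV. \<Sum>j\<in>UNIV. J (\<lambda>x. (euler (angular i j u) x)\<^sup>2)
        + J' (\<lambda>x. angular i j u x * euler (angular i j u) x))
      \<le> (\<Sum>i\<in>UNIV. \<Sum>j\<in>UNIV. J (\<lambda>x. g x * angular i j (angular i j u) x))"
  proof (intro sum_mono)
    fix i j :: 'n
    \<comment> \<open>Since 2 <= q <= n, both terms are nonnegative and can be discarded.\<close>
    have "0 \<le> (q - 2) * (CARD('n) - q) / 2 * J (\<lambda>x. (angular i j u x)\<^sup>2)"
         "0 \<le> (q - 2) / 2 * J' (\<lambda>x. (angular i j u x)\<^sup>2)"
      using q by (simp_all add: J_nonneg)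
    then show "J (\<lambda>x. (euler (angular i j u) x)\<^sup>2) + J' (\<lambda>x. angular i j u x * euler (angular i j u) x)
        \<le> J (\<lambda>x. g x * angular i j (angular i j u) x)"
      using J_angular_parts[OF u, of i j] by (simp add: g_def e_def)
  qed
  moreover have "(2 * ?\<alpha>) * J (\<lambda>x. e x * euler e x) =
      - ?\<alpha> * (CARD('n) - q) * J (\<lambda>x. (e x)\<^sup>2) - ?\<alpha> * J' (\<lambda>x. (e x)\<^sup>2)"
    unfolding J_mult_euler[OF e] by (simp add: field_simps)
  ultimately show ?thesis
    by (simp add: sum.distrib e_def algebra_simps)
qed

text \<open>Hardy's inequality with the potential of \<open>t\<close>, for \<open>euler u\<close>
  and all \<open>angular i j u\<close>, produces the Dirichlet integral. The square of
  \<open>euler u\<close> that remains has coefficient ((n + q - 4) / 2)^2, and Hardy's inequality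
  for \<open>u\<close> with \<open>V\<close> is applied to it.\<close>

lemma hardy_rellich_cutoff:
  fixes u :: "real ^ 'n \<Rightarrow> real"
  assumes u: "adm u" and s: "riccati_solution V R s s'" and "0 \<le> c"
    and t: "riccati_solution (\<lambda>r. c * r powr (q - 4) * r\<^sup>2) R t t'"
  shows "((CARD('n) + q - 4) / 2)\<^sup>2 * (((CARD('n) - q) / 2)\<^sup>2 * J (\<lambda>x. (u x)\<^sup>2)
        + integral\<^sup>L lborel (\<lambda>x. P (norm x) * V (norm x) * (u x)\<^sup>2))
      + c * integral\<^sup>L lborel (\<lambda>x. \<phi> (norm x) * (norm (grad u x))\<^sup>2)
    \<le> J (\<lambda>x. ((norm x)\<^sup>2 * laplacian u x)\<^sup>2)
      + J' (\<lambda>x. (real CARD('n) - 2) * (euler u x)\<^sup>2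
          - (\<Sum>i\<in>UNIV. \<Sum>j\<in>UNIV. angular i j u x * euler (angular i j u) x))"
proof -
  let ?V = "\<lambda>r. c * r powr (q - 4) * r\<^sup>2"
  let ?I = "\<lambda>f. integral\<^sup>L lborel (\<lambda>x. P (norm x) * ?V (norm x) * f x)"
  let ?e = "euler u" and ?w = "\<lambda>i j. angular i j u"
  let ?\<alpha> = "real CARD('n) - 2" and ?\<gamma> = "(real CARD('n) - q) / 2"
  have contV: "continuous_on {0<..<R} ?V" using t by (simp add: riccati_solution_def)
  note int = integrable_weighted(1)[OF contV]
  have grad_adm: "adm (\<lambda>x. (norm (grad u x))\<^sup>2)"
    unfolding norm_grad_squared using u
    by (intro adm_sum adm_square) (simp add: adm_def smooth_partial_deriv vanishes_beyond_partial_deriv)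
  \<comment> \<open>The powers of \<open>r\<close> have total exponent 0: exactly this potential
    cancels the weight and leaves an unweighted Dirichlet integral.\<close>
  have Pc: "P r * ?V r * (r\<^sup>2 * y) = c * (\<phi> r * y)" if "0 \<le> r" for r y
  proof (cases "r = 0")
    case True
    then show ?thesis using \<phi> a_pos by (simp add: P_def radial_weight_def)
  next
    case False
    with that have "r powr (- q) * r powr (q - 4) * (r\<^sup>2 * r\<^sup>2) = r powr (- q + (q - 4) + (2 + 2))"
      by (simp only: powr_add) (simp add: powr_numeral)
    then show ?thesis using False that by (simp add: P_def mult_ac)
  qed
  have "c * integral\<^sup>L lborel (\<lambda>x. \<phi> (norm x) * (norm (grad u x))\<^sup>2)
      = integral\<^sup>L lborel (\<lambda>x. P (norm x) * ?V (norm x) * ((norm x)\<^sup>2 * (norm (grad u x))\<^sup>2))"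
    by (simp add: Pc)
  also have "\<dots> \<le> ?I (\<lambda>x. (?e x)\<^sup>2 + (\<Sum>i\<in>UNIV. \<Sum>j\<in>UNIV. (?w i j x)\<^sup>2))"
  proof (rule integral_mono)
    have "integrable lborel (\<lambda>x. \<phi> (norm x) * (norm (grad u x))\<^sup>2)"
      using grad_adm \<phi> a_pos
      by (intro integrable_radial[OF radial_weight_continuous[OF \<phi>] a_pos _ b])
        (auto simp: radial_weight_def adm_def smooth_continuous)
    then show "integrable lborel (\<lambda>x. P (norm x) * ?V (norm x) * ((norm x)\<^sup>2 * (norm (grad u x))\<^sup>2))"
      by (simp add: Pc)
    fix x :: "real ^ 'n"
    have "(?e x)\<^sup>2 \<le> (norm x)\<^sup>2 * (norm (grad u x))\<^sup>2"
    proof -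
      have "?e x = x \<bullet> grad u x" by (simp add: euler_def grad_def inner_vec_def)
      then show ?thesis using Cauchy_Schwarz_ineq[of x "grad u x"]
        by (simp add: power2_norm_eq_inner)
    qed
    \<comment> \<open>By Lagrange's identity the right side is 2 |x|^2 |grad u|^2 minus the square
      of \<open>euler u x\<close>; the Cauchy-Schwarz bound just proved absorbs the subtracted
      square.\<close>
    then have "(norm x)\<^sup>2 * (norm (grad u x))\<^sup>2 \<le> (?e x)\<^sup>2 + (\<Sum>i\<in>UNIV. \<Sum>j\<in>UNIV. (?w i j x)\<^sup>2)"
      by (simp add: sum_angular_squares)
    then show "P (norm x) * ?V (norm x) * ((norm x)\<^sup>2 * (norm (grad u x))\<^sup>2)
        \<le> P (norm x) * ?V (norm x) * ((?e x)\<^sup>2 + (\<Sum>i\<in>UNIV. \<Sum>j\<in>UNIV. (?w i j x)\<^sup>2))"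
      using assms(3) by (intro mult_left_mono) (simp_all add: P_nonneg)
  qed (intro int adm_intros u)
  also have "\<dots> = ?I (\<lambda>x. (?e x)\<^sup>2) + (\<Sum>i\<in>UNIV. \<Sum>j\<in>UNIV. ?I (\<lambda>x. (?w i j x)\<^sup>2))"
    unfolding distrib_left sum_distrib_left
    by (subst Bochner_Integration.integral_add Bochner_Integration.integral_sum; (intro int Bochner_Integration.integrable_sum adm_intros u)?)+ simp
  finally have 1: "c * integral\<^sup>L lborel (\<lambda>x. \<phi> (norm x) * (norm (grad u x))\<^sup>2)
      \<le> ?I (\<lambda>x. (?e x)\<^sup>2) + (\<Sum>i\<in>UNIV. \<Sum>j\<in>UNIV. ?I (\<lambda>x. (?w i j x)\<^sup>2))" .
  have "?I (\<lambda>x. (?w i j x)\<^sup>2) \<le> J (\<lambda>x. (euler (?w i j) x)\<^sup>2)" for i j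
  proof -
    \<comment> \<open>For the angular derivatives only the potential term of Hardy's inequality is
      kept.\<close>
    have "0 \<le> ?\<gamma>\<^sup>2 * J (\<lambda>x. (?w i j x)\<^sup>2)" by (simp add: J_nonneg)
    then show ?thesis using hardy[OF t adm_angular[OF u], of i j] by linarith
  qed
  then have 2: "(\<Sum>i\<in>UNIV. \<Sum>j\<in>UNIV. ?I (\<lambda>x. (?w i j x)\<^sup>2))
      \<le> (\<Sum>i\<in>UNIV. \<Sum>j\<in>UNIV. J (\<lambda>x. (euler (?w i j) x)\<^sup>2))"
    by (intro sum_mono)
  have 3: "?\<gamma>\<^sup>2 * J (\<lambda>x. (?e x)\<^sup>2) + ?I (\<lambda>x. (?e x)\<^sup>2) \<le> J (\<lambda>x. (euler ?e x)\<^sup>2)"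
    by (rule hardy[OF t adm_euler[OF u]])
  \<comment> \<open>The Hardy constant for \<open>euler u\<close> completes the square of the
    coefficient in \<open>laplacian_lower_bound\<close>.\<close>
  have sq: "?\<gamma>\<^sup>2 + (?\<alpha>\<^sup>2 - ?\<alpha> * (CARD('n) - q)) = ((CARD('n) + q - 4) / 2)\<^sup>2"
    by (simp add: power2_eq_square field_simps)
  have "((CARD('n) + q - 4) / 2)\<^sup>2 * (?\<gamma>\<^sup>2 * J (\<lambda>x. (u x)\<^sup>2)
        + integral\<^sup>L lborel (\<lambda>x. P (norm x) * V (norm x) * (u x)\<^sup>2))
      \<le> ((CARD('n) + q - 4) / 2)\<^sup>2 * J (\<lambda>x. (?e x)\<^sup>2)"
    by (intro mult_left_mono hardy[OF s u]) simp
  also have "\<dots> = ?\<gamma>\<^sup>2 * J (\<lambda>x. (?e x)\<^sup>2) + (?\<alpha>\<^sup>2 - ?\<alpha> * (CARD('n) - q)) * J (\<lambda>x. (?e x)\<^sup>2)"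
    unfolding sq[symmetric] by (simp add: algebra_simps)
  finally have 4: "((CARD('n) + q - 4) / 2)\<^sup>2 * (?\<gamma>\<^sup>2 * J (\<lambda>x. (u x)\<^sup>2)
        + integral\<^sup>L lborel (\<lambda>x. P (norm x) * V (norm x) * (u x)\<^sup>2))
      \<le> ?\<gamma>\<^sup>2 * J (\<lambda>x. (?e x)\<^sup>2) + (?\<alpha>\<^sup>2 - ?\<alpha> * (CARD('n) - q)) * J (\<lambda>x. (?e x)\<^sup>2)" .
  have "J' (\<lambda>x. ?\<alpha> * (?e x)\<^sup>2 - (\<Sum>i\<in>UNIV. \<Sum>j\<in>UNIV. ?w i j x * euler (?w i j) x))
      = ?\<alpha> * J' (\<lambda>x. (?e x)\<^sup>2) - (\<Sum>i\<in>UNIV. \<Sum>j\<in>UNIV. J' (\<lambda>x. ?w i j x * euler (?w i j) x))"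
  proof -
    have i: "integrable lborel (\<lambda>x. ?\<alpha> * (P' (norm x) * (?e x)\<^sup>2))"
        "\<And>i j. integrable lborel (\<lambda>x. P' (norm x) * (?w i j x * euler (?w i j) x))"
      by (intro integrable_mult_right integrable_P adm_intros u)+
    have "J' (\<lambda>x. ?\<alpha> * (?e x)\<^sup>2 - (\<Sum>i\<in>UNIV. \<Sum>j\<in>UNIV. ?w i j x * euler (?w i j) x))
        = integral\<^sup>L lborel (\<lambda>x. ?\<alpha> * (P' (norm x) * (?e x)\<^sup>2)
          - (\<Sum>i\<in>UNIV. \<Sum>j\<in>UNIV. P' (norm x) * (?w i j x * euler (?w i j) x)))"
      unfolding J'_def by (simp add: right_diff_distrib sum_distrib_left mult_ac)
    also have "\<dots> = ?\<alpha> * J' (\<lambda>x. (?e x)\<^sup>2) - (\<Sum>i\<in>UNIV. \<Sum>j\<in>UNIV. J' (\<lambda>x. ?w i j x * euler (?w i j) x))"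
      unfolding J'_def using i by (simp add: integral_mult_right_zero)
    finally show ?thesis .
  qed
  with 1 2 3 4 laplacian_lower_bound[OF u] show ?thesis by linarith
qed

end


subsection \<open>Removing the cutoff\<close>

text \<open>A nondecreasing C^1 step from 0 (up to 1) to 1 (from 2 on), equal to (1 - (2 - t)^2)^2
  in between. Squares of positive parts make it C^1 at both ends.\<close>

definition cutoff :: "real \<Rightarrow> real" where
  "cutoff t = (max 0 (1 - (max 0 (2 - t))\<^sup>2))\<^sup>2"

definition cutoff' :: "real \<Rightarrow> real" where
  "cutoff' t = 4 * max 0 (1 - (max 0 (2 - t))\<^sup>2) * max 0 (2 - t)"

text \<open>Only the origin needs an argument: there the difference quotient is bounded by
  |h|.\<close>

lemma has_real_derivative_max_0_square:
  "((\<lambda>x. (max 0 x)\<^sup>2) has_real_derivative 2 * max 0 x) (at (x::real))"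
proof (cases x "0::real" rule: linorder_cases)
  case less
  then have "((\<lambda>x. (max 0 x)\<^sup>2) has_real_derivative 0) (at x)"
    by (intro has_field_derivative_transform_within_open[OF DERIV_const, of "{..<0}"]) auto
  with less show ?thesis by simp
next
  case greater
  have "((\<lambda>x. x\<^sup>2) has_real_derivative 2 * x) (at x)"
    by (auto intro!: derivative_eq_intros)
  then have "((\<lambda>x. (max 0 x)\<^sup>2) has_real_derivative 2 * x) (at x)"
    by (rule has_field_derivative_transform_within_open[of _ _ _ "{0<..}"]) (use greater in auto)
  with greater show ?thesis by simp
next
  case equal
  have "((\<lambda>h::real. (max 0 h)\<^sup>2 / h) \<longlongrightarrow> 0) (at 0)"
  proof (rule Lim_null_comparison)
    show "\<forall>\<^sub>F h in at 0. norm ((max 0 h)\<^sup>2 / h) \<le> \<bar>h :: real\<bar>"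
      by (intro always_eventually allI) (simp add: max_def power2_eq_square)
    show "((\<lambda>h::real. \<bar>h\<bar>) \<longlongrightarrow> 0) (at 0)" by (intro tendsto_rabs_zero tendsto_ident_at)
  qed
  then show ?thesis by (simp add: equal DERIV_def)
qed

lemma has_real_derivative_cutoff: "(cutoff has_real_derivative cutoff' t) (at t)"
proof -
  have 1: "((\<lambda>t. 1 - (max 0 (2 - t))\<^sup>2) has_real_derivative 0 - (2 * max 0 (2 - t)) * (0 - 1)) (at t)"
    by (intro DERIV_diff DERIV_const DERIV_chain2[OF has_real_derivative_max_0_square] DERIV_ident)
  from DERIV_chain2[OF has_real_derivative_max_0_square 1] show ?thesis
    unfolding cutoff_def[abs_def] cutoff'_def by (simp add: mult.assoc)
qed

lemma cutoff_nonneg: "0 \<le> cutoff t" "0 \<le> cutoff' t"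
  by (simp_all add: cutoff_def cutoff'_def)

lemma cutoff_le_1: "cutoff t \<le> 1"
proof -
  have "max 0 (1 - (max 0 (2 - t))\<^sup>2) \<le> 1" by simp
  then show ?thesis unfolding cutoff_def by (intro power_le_one) auto
qed

lemma cutoff_eq_0: "t \<le> 1 \<Longrightarrow> cutoff t = 0" "t \<le> 1 \<Longrightarrow> cutoff' t = 0"
proof -
  assume "t \<le> 1"
  then have "1\<^sup>2 \<le> (max 0 (2 - t))\<^sup>2" by (intro power_mono) auto
  then have "max 0 (1 - (max 0 (2 - t))\<^sup>2) = 0" by simp
  then show "cutoff t = 0" "cutoff' t = 0" by (simp_all add: cutoff_def cutoff'_def)
qed

lemma cutoff_ge_2: "2 \<le> t \<Longrightarrow> cutoff t = 1" "2 \<le> t \<Longrightarrow> cutoff' t = 0"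
  by (simp_all add: cutoff_def cutoff'_def)

lemma cutoff'_le_4: "cutoff' t \<le> 4"
proof (cases "t \<le> 1")
  case False
  have "max 0 (1 - (max 0 (2 - t))\<^sup>2) * max 0 (2 - t) \<le> 1 * 1"
    using False by (intro mult_mono) auto
  then show ?thesis by (simp add: cutoff'_def)
qed (simp add: cutoff_eq_0)

lemma cutoff_mono: "s \<le> t \<Longrightarrow> cutoff s \<le> cutoff t"
  using has_real_derivative_cutoff cutoff_nonneg(2) by (rule_tac DERIV_nonneg_imp_nondecreasing) blast+

lemma continuous_on_cutoff: "continuous_on A cutoff"
  using has_real_derivative_cutoff by (meson DERIV_isCont continuous_at_imp_continuous_on)

lemma radial_weight_cutoff:
  assumes "0 < \<epsilon>"
  shows "radial_weight \<epsilon> R (\<lambda>r. cutoff (r / \<epsilon>)) (\<lambda>r. cutoff' (r / \<epsilon>) * (1 / \<epsilon>))"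
  unfolding radial_weight_def
proof (intro conjI ballI allI impI assms)
  show "continuous_on {0<..<R} (\<lambda>r. cutoff' (r / \<epsilon>) * (1 / \<epsilon>))"
    unfolding cutoff'_def using assms by (intro continuous_intros) auto
  show "((\<lambda>r. cutoff (r / \<epsilon>)) has_real_derivative cutoff' (r / \<epsilon>) * (1 / \<epsilon>)) (at r)" for r
    by (rule DERIV_chain2[OF has_real_derivative_cutoff DERIV_cdivide[OF DERIV_ident]])
  fix r assume "r < \<epsilon>"
  then have "r / \<epsilon> \<le> 1" using assms by simp
  then show "cutoff (r / \<epsilon>) = 0" "cutoff' (r / \<epsilon>) * (1 / \<epsilon>) = 0"
    by (simp_all add: cutoff_eq_0)
qed

text \<open>On the shell between \<epsilon> and 2 \<epsilon> the cutoff factor is bounded and the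
  rest is at most C times \<epsilon> to the power 2 - q, while the volume is of order \<epsilon> to
  the power n. The exponents add up to n + 2 - q.\<close>

lemma integral_over_shell_le:
  fixes h :: "real ^ 'n::finite \<Rightarrow> real" and q :: real
  assumes "0 < \<epsilon>" "\<epsilon> \<le> 1" "2 \<le> q" "q \<le> CARD('n)" "0 \<le> C" and h: "\<And>x. h x \<le> C * (norm x)\<^sup>2"
    and int: "integrable lborel (\<lambda>x. norm x * (cutoff' (norm x / \<epsilon>) * (1 / \<epsilon>)) * norm x powr (- q) * h x)"
  shows "integral\<^sup>L lborel (\<lambda>x. norm x * (cutoff' (norm x / \<epsilon>) * (1 / \<epsilon>)) * norm x powr (- q) * h x)
    \<le> 8 * C * (unit_ball_vol (CARD('n)) * 2 ^ CARD('n)) * \<epsilon>\<^sup>2"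
proof -
  let ?f = "\<lambda>x. norm x * (cutoff' (norm x / \<epsilon>) * (1 / \<epsilon>)) * norm x powr (- q) * h x"
  let ?M = "8 * C * \<epsilon> powr (2 - q)"
  have le: "?f x \<le> ?M * indicator (cball 0 (2 * \<epsilon>)) x" for x
  proof (cases "\<epsilon> < norm x \<and> norm x < 2 * \<epsilon>")
    case False
    then have "norm x / \<epsilon> \<le> 1 \<or> 2 \<le> norm x / \<epsilon>" using assms(1) by (auto simp: field_simps)
    then have "cutoff' (norm x / \<epsilon>) = 0" using cutoff_eq_0 cutoff_ge_2 by blast
    then show ?thesis using assms by simp
  next
    case True
    define r where "r = norm x"
    have r: "\<epsilon> < r" "r < 2 * \<epsilon>" "0 < r" using True assms(1) by (auto simp: r_def)
    have "r * (cutoff' (r / \<epsilon>) * (1 / \<epsilon>)) = (r / \<epsilon>) * cutoff' (r / \<epsilon>)" by simp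
    \<comment> \<open>On the shell \<open>r / \<epsilon>\<close> is below 2, and 4 bounds the
      derivative of the cutoff.\<close>
    also have "\<dots> \<le> 2 * 4"
      using r assms(1) by (intro mult_mono cutoff'_le_4) (auto simp: cutoff_nonneg field_simps)
    finally have A: "r * (cutoff' (r / \<epsilon>) * (1 / \<epsilon>)) \<le> 8" by simp
    have A0: "0 \<le> r * (cutoff' (r / \<epsilon>) * (1 / \<epsilon>))"
      using r assms(1) by (simp add: cutoff_nonneg)
    have "r powr (- q) * h x \<le> r powr (- q) * (C * r\<^sup>2)"
      by (intro mult_left_mono) (use h[of x] in \<open>simp_all add: r_def\<close>)
    also have "\<dots> = C * r powr (2 - q)"
      using r by (simp add: powr_diff powr_minus powr_numeral field_simps)
    also have "\<dots> \<le> C * \<epsilon> powr (2 - q)"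
      using r assms by (intro mult_left_mono powr_mono2') auto
    finally have B: "r powr (- q) * h x \<le> C * \<epsilon> powr (2 - q)" .
    have "?f x = (r * (cutoff' (r / \<epsilon>) * (1 / \<epsilon>))) * (r powr (- q) * h x)"
      by (simp add: r_def)
    also have "\<dots> \<le> (r * (cutoff' (r / \<epsilon>) * (1 / \<epsilon>))) * (C * \<epsilon> powr (2 - q))"
      by (rule mult_left_mono[OF B A0])
    also have "\<dots> \<le> 8 * (C * \<epsilon> powr (2 - q))"
      using assms(5) by (intro mult_right_mono[OF A]) simp
    finally have "?f x \<le> 8 * (C * \<epsilon> powr (2 - q))" .
    then show ?thesis using r by (simp add: r_def)
  qed
  have fin: "emeasure lborel (cball 0 (2 * \<epsilon>) :: (real ^ 'n) set) < \<infinity>"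
    by (rule emeasure_bounded_finite) simp
  have "integral\<^sup>L lborel ?f \<le> integral\<^sup>L lborel (\<lambda>x :: real ^ 'n. ?M * indicator (cball 0 (2 * \<epsilon>)) x)"
    by (rule integral_mono[OF int _ le]) (intro integrable_mult_right integrable_real_indicator; use fin in simp)
  also have "\<dots> = ?M * measure lborel (cball 0 (2 * \<epsilon>) :: (real ^ 'n) set)"
    by simp
  also have "measure lborel (cball 0 (2 * \<epsilon>) :: (real ^ 'n) set) = unit_ball_vol (CARD('n)) * (2 * \<epsilon>) ^ CARD('n)"
    using content_cball[of "2 * \<epsilon>" "0 :: real ^ 'n"] assms(1) by simp
  also have "(2 * \<epsilon>) ^ CARD('n) = 2 ^ CARD('n) * \<epsilon> powr CARD('n)"
    using assms(1) by (simp add: power_mult_distrib powr_realpow)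
  also have "?M * (unit_ball_vol (CARD('n)) * (2 ^ CARD('n) * \<epsilon> powr CARD('n)))
      = 8 * C * (unit_ball_vol (CARD('n)) * 2 ^ CARD('n)) * \<epsilon> powr (2 - q + CARD('n))"
    by (simp add: powr_add)
  \<comment> \<open>The exponent is at least 2 because q <= n, and \<epsilon> is at most 1.\<close>
  also have "\<dots> \<le> 8 * C * (unit_ball_vol (CARD('n)) * 2 ^ CARD('n)) * \<epsilon> powr 2"
    using assms by (intro mult_left_mono powr_mono') auto
  also have "\<epsilon> powr 2 = \<epsilon>\<^sup>2" using assms(1) by (simp add: powr_numeral)
  finally show ?thesis .
qed

section \<open>Order of vanishing at the origin\<close>

text \<open>What matters is small \<open>x\<close>: Euler and angular derivatives carry a coordinate
  factor and vanish to first order there. Their products, which make up the cutoff error, vanish to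
  second order.\<close>

definition linear_growth :: "(real ^ 'n::finite \<Rightarrow> real) \<Rightarrow> bool" where
  "linear_growth f \<longleftrightarrow> (\<exists>B. \<forall>x. \<bar>f x\<bar> \<le> B * norm x)"

definition quadratic_growth :: "(real ^ 'n::finite \<Rightarrow> real) \<Rightarrow> bool" where
  "quadratic_growth f \<longleftrightarrow> (\<exists>B. \<forall>x. \<bar>f x\<bar> \<le> B * (norm x)\<^sup>2)"

lemma linear_growth_diff:
  assumes "linear_growth f" "linear_growth g"
  shows "linear_growth (\<lambda>x. f x - g x)"
proof -
  obtain A B where "\<And>x. \<bar>f x\<bar> \<le> A * norm x" "\<And>x. \<bar>g x\<bar> \<le> B * norm x"
    using assms unfolding linear_growth_def by blast
  then have "\<bar>f x - g x\<bar> \<le> (A + B) * norm x" for x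
    unfolding distrib_right by (meson abs_triangle_ineq4 add_mono order_trans)
  then show ?thesis unfolding linear_growth_def by blast
qed

lemma linear_growth_sum:
  assumes "\<And>i. i \<in> I \<Longrightarrow> linear_growth (f i)"
  shows "linear_growth (\<lambda>x. \<Sum>i\<in>I. f i x)"
proof -
  obtain B where B: "\<And>i x. i \<in> I \<Longrightarrow> \<bar>f i x\<bar> \<le> B i * norm x"
    using assms unfolding linear_growth_def by metis
  have "\<bar>\<Sum>i\<in>I. f i x\<bar> \<le> (\<Sum>i\<in>I. B i) * norm x" for x
    unfolding sum_distrib_right using B by (intro order_trans[OF sum_abs] sum_mono) auto
  then show ?thesis unfolding linear_growth_def by blast
qed

lemma quadratic_growth_diff:
  assumes "quadratic_growth f" "quadratic_growth g"
  shows "quadratic_growth (\<lambda>x. f x - g x)"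
proof -
  obtain A B where "\<And>x. \<bar>f x\<bar> \<le> A * (norm x)\<^sup>2" "\<And>x. \<bar>g x\<bar> \<le> B * (norm x)\<^sup>2"
    using assms unfolding quadratic_growth_def by blast
  then have "\<bar>f x - g x\<bar> \<le> (A + B) * (norm x)\<^sup>2" for x
    unfolding distrib_right by (meson abs_triangle_ineq4 add_mono order_trans)
  then show ?thesis unfolding quadratic_growth_def by blast
qed

lemma quadratic_growth_sum:
  assumes "\<And>i. i \<in> I \<Longrightarrow> quadratic_growth (f i)"
  shows "quadratic_growth (\<lambda>x. \<Sum>i\<in>I. f i x)"
proof -
  obtain B where B: "\<And>i x. i \<in> I \<Longrightarrow> \<bar>f i x\<bar> \<le> B i * (norm x)\<^sup>2"
    using assms unfolding quadratic_growth_def by metis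
  have "\<bar>\<Sum>i\<in>I. f i x\<bar> \<le> (\<Sum>i\<in>I. B i) * (norm x)\<^sup>2" for x
    unfolding sum_distrib_right using B by (intro order_trans[OF sum_abs] sum_mono) auto
  then show ?thesis unfolding quadratic_growth_def by blast
qed

lemma quadratic_growth_cmult:
  assumes "quadratic_growth f"
  shows "quadratic_growth (\<lambda>x. c * f x)"
proof -
  obtain B where "\<And>x. \<bar>f x\<bar> \<le> B * (norm x)\<^sup>2"
    using assms unfolding quadratic_growth_def by blast
  then have "\<bar>c * f x\<bar> \<le> (\<bar>c\<bar> * B) * (norm x)\<^sup>2" for x
    by (simp add: abs_mult mult.assoc mult_left_mono)
  then show ?thesis unfolding quadratic_growth_def by blast
qed

lemma quadratic_growth_mult:
  assumes "linear_growth f" "linear_growth g"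
  shows "quadratic_growth (\<lambda>x. f x * g x)"
proof -
  obtain A B where AB: "\<And>x. \<bar>f x\<bar> \<le> A * norm x" "\<And>x. \<bar>g x\<bar> \<le> B * norm x"
    using assms unfolding linear_growth_def by blast
  have "\<bar>f x * g x\<bar> \<le> (A * B) * (norm x)\<^sup>2" for x
  proof -
    have "\<bar>f x * g x\<bar> \<le> (A * norm x) * (B * norm x)"
      unfolding abs_mult using AB[of x] by (intro mult_mono) (auto intro: order_trans[OF abs_ge_zero])
    then show ?thesis by (simp add: power2_eq_square mult_ac)
  qed
  then show ?thesis unfolding quadratic_growth_def by blast
qed

lemma linear_growth_nth_mult:
  assumes "smooth f" "vanishes_beyond b f"
  shows "linear_growth (\<lambda>x. x $ i * f x)"
proof -
  have "bounded (f ` cball 0 b)"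
    by (intro compact_imp_bounded compact_continuous_image smooth_continuous assms compact_cball)
  then obtain B where B: "0 < B" "\<And>x. x \<in> cball 0 b \<Longrightarrow> \<bar>f x\<bar> \<le> B"
    by (auto simp: bounded_pos)
  have "\<bar>f x\<bar> \<le> B" for x
    using B assms(2) by (cases "norm x \<le> b") (auto simp: vanishes_beyond_def)
  then have "\<bar>x $ i * f x\<bar> \<le> B * norm x" for x
    unfolding abs_mult mult.commute[of B] by (intro mult_mono component_le_norm_cart) auto
  then show ?thesis unfolding linear_growth_def by blast
qed

lemma linear_growth_euler: "smooth f \<Longrightarrow> vanishes_beyond b f \<Longrightarrow> linear_growth (euler f)"
  unfolding euler_def[abs_def]
  by (intro linear_growth_sum linear_growth_nth_mult smooth_partial_deriv vanishes_beyond_partial_deriv)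

lemma linear_growth_angular: "smooth f \<Longrightarrow> vanishes_beyond b f \<Longrightarrow> linear_growth (angular i j f)"
  unfolding angular_def[abs_def]
  by (intro linear_growth_diff linear_growth_nth_mult smooth_partial_deriv vanishes_beyond_partial_deriv)

section \<open>Limits of the cut-off integrals\<close>

text \<open>Monotone convergence: as the radius \<open>1 / Suc k\<close> shrinks, the cutoffs
  increase to 1 off the origin. The limit may be infinite.\<close>

lemma nn_integral_cutoff_limit:
  fixes g :: "real ^ 'n::finite \<Rightarrow> real"
  assumes g: "continuous_on (ball 0 R - {0}) g" "\<And>x. x \<in> ball 0 R - {0} \<Longrightarrow> 0 \<le> g x"
  shows "(\<lambda>k. \<integral>\<^sup>+x\<in>ball 0 R. ennreal (cutoff (norm x / (1 / Suc k)) * g x) \<partial>lborel)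
    \<longlonglongrightarrow> (\<integral>\<^sup>+x\<in>ball 0 R. ennreal (g x) \<partial>lborel)"
proof -
  \<comment> \<open>\<open>g\<close> is controlled only in the punctured ball; setting it to 0
    elsewhere makes it measurable and changes the integrals over the ball on a null set
    only.\<close>
  define h where "h = (\<lambda>x. indicator (ball 0 R - {0}) x *\<^sub>R g x)"
  define F where "F = (\<lambda>k x. ennreal (cutoff (norm x / (1 / Suc k)) * h x))"
  have [measurable]: "h \<in> borel_measurable borel"
    unfolding h_def by (intro borel_measurable_continuous_on_indicator g) auto
  have [measurable]: "cutoff \<in> borel_measurable borel"
    by (intro borel_measurable_continuous_onI continuous_on_cutoff)
  have ae: "AE x in lborel. x \<noteq> (0 :: real ^ 'n)"
    by (rule AE_lborel_singleton)
  have h0: "0 \<le> h x" for x using g(2)[of x] by (auto simp: h_def indicator_def)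
  have "incseq F"
  proof (intro monoI le_funI)
    fix k l :: nat and x :: "real ^ 'n" assume "k \<le> l"
    then have "norm x / (1 / Suc k) \<le> norm x / (1 / Suc l)"
      by (auto intro!: mult_left_mono)
    then show "F k x \<le> F l x"
      unfolding F_def by (intro ennreal_leI mult_right_mono cutoff_mono h0)
  qed
  moreover have [measurable]: "F k \<in> borel_measurable lborel" for k
    unfolding F_def by measurable
  ultimately have "(\<integral>\<^sup>+x. (SUP k. F k x) \<partial>lborel) = (SUP k. integral\<^sup>N lborel (F k))"
    by (rule nn_integral_monotone_convergence_SUP)
  moreover have "(SUP k. F k x) = ennreal (h x)" for x
  proof (cases "x = 0")
    case True
    then show ?thesis by (simp add: F_def h_def)
  next
    case False
    show ?thesis
    proof (rule antisym)
      show "(SUP k. F k x) \<le> ennreal (h x)"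
        unfolding F_def using cutoff_le_1 h0 by (intro SUP_least ennreal_leI mult_left_le_one_le cutoff_nonneg)
      \<comment> \<open>Once \<open>k\<close> exceeds \<open>2 / norm x\<close>, the cutoff equals 1
        at \<open>x\<close> and the supremum is attained.\<close>
      obtain k :: nat where "2 / norm x < k" using reals_Archimedean2 by blast
      then have "2 < k * norm x" using False by (simp add: field_simps)
      also have "\<dots> \<le> norm x / (1 / Suc k)" by (simp add: algebra_simps)
      finally have "2 \<le> norm x / (1 / Suc k)" by simp
      then have "F k x = ennreal (h x)" by (simp add: F_def cutoff_ge_2)
      then show "ennreal (h x) \<le> (SUP k. F k x)" by (metis SUP_upper UNIV_I)
    qed
  qed
  moreover have "(\<lambda>k. integral\<^sup>N lborel (F k)) \<longlonglongrightarrow> (SUP k. integral\<^sup>N lborel (F k))"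
    using \<open>incseq F\<close> by (intro LIMSEQ_SUP) (auto simp: incseq_def le_fun_def intro!: nn_integral_mono)
  ultimately have "(\<lambda>k. integral\<^sup>N lborel (F k)) \<longlonglongrightarrow> (\<integral>\<^sup>+x. ennreal (h x) \<partial>lborel)"
    by simp
  moreover have "integral\<^sup>N lborel (F k) = (\<integral>\<^sup>+x\<in>ball 0 R. ennreal (cutoff (norm x / (1 / Suc k)) * g x) \<partial>lborel)" for k
    by (intro nn_integral_cong_AE eventually_mono[OF ae]) (auto simp: F_def h_def indicator_def)
  moreover have "(\<integral>\<^sup>+x. ennreal (h x) \<partial>lborel) = (\<integral>\<^sup>+x\<in>ball 0 R. ennreal (g x) \<partial>lborel)"
    by (intro nn_integral_cong_AE eventually_mono[OF ae]) (auto simp: h_def indicator_def)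
  ultimately show ?thesis by simp
qed

text \<open>The norm attains its maximum on the compact support, which lies in the open ball. The
  gap below \<open>R\<close> keeps \<open>u\<close> away from radii where a potential may be
  singular; if the support is empty, 0 serves as \<open>b\<close>.\<close>

lemma test_function_radius:
  fixes u :: "real ^ 'n::finite \<Rightarrow> real"
  assumes "test_function (ball 0 R) u" "0 < R"
  obtains b where "b < R" "vanishes_beyond b u"
proof -
  let ?K = "closure {x. u x \<noteq> 0}"
  have K: "compact ?K" "?K \<subseteq> ball 0 R" using assms by (auto simp: test_function_def)
  show ?thesis
  proof (cases "?K = {}")
    case True
    then have "vanishes_beyond 0 u" by (auto simp: vanishes_beyond_def)
    with assms(2) that show ?thesis by blast
  next
    case False
    obtain z where z: "z \<in> ?K" "\<And>x. x \<in> ?K \<Longrightarrow> norm x \<le> norm z"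
      using continuous_attains_sup[OF K(1) False, of norm] by (auto intro: continuous_intros)
    have "norm z < R" using z(1) K(2) by auto
    moreover have "vanishes_beyond (norm z) u"
      unfolding vanishes_beyond_def
    proof (intro allI impI)
      fix x :: "real ^ 'n" assume "norm z < norm x"
      then have "x \<notin> ?K" using z(2) by force
      then show "u x = 0" using closure_subset[of "{x. u x \<noteq> 0}"] by auto
    qed
    ultimately show ?thesis by (rule that)
  qed
qed

text \<open>Links the extended integrals over the ball with the Bochner integrals of the cut-off
  inequality.\<close>

lemma nn_integral_ball_eq_integral:
  fixes g h :: "'a::euclidean_space \<Rightarrow> real"
  assumes "integrable lborel h" "\<And>x. norm x < R \<Longrightarrow> g x = h x" "\<And>x. norm x < R \<Longrightarrow> 0 \<le> h x"
    and "\<And>x. R \<le> norm x \<Longrightarrow> h x = 0"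
  shows "(\<integral>\<^sup>+x\<in>ball 0 R. ennreal (g x) \<partial>lborel) = ennreal (integral\<^sup>L lborel h)"
proof -
  have "(\<integral>\<^sup>+x\<in>ball 0 R. ennreal (g x) \<partial>lborel) = (\<integral>\<^sup>+x. ennreal (h x) \<partial>lborel)"
    using assms by (intro nn_integral_cong) (auto simp: indicator_def not_less)
  also have "\<dots> = ennreal (integral\<^sup>L lborel h)"
  proof (rule nn_integral_eq_integral[OF assms(1)], rule AE_I2)
    show "0 \<le> h x" for x using assms(3,4)[of x] by (cases "norm x < R") auto
  qed
  finally show ?thesis .
qed

section \<open>The inequality for fixed admissible constants\<close>

lemma hardy_rellich_admissible_constants:
  fixes m R c d :: real and W :: "real \<Rightarrow> real" and u :: "real ^ 'n::finite \<Rightarrow> real" and n :: real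
  defines "n \<equiv> real CARD('n)"
  assumes R: "R > 0" and m: "-1 < m" "m \<le> (n - 4) / 2"
    and W: "continuous_on {0<..<R} W" "\<And>r. r \<in> {0<..<R} \<Longrightarrow> 0 \<le> W r"
    and c: "0 \<le> c" "has_positive_bessel_solution W R c"
    and d: "0 \<le> d" "has_positive_bessel_solution (\<lambda>r. r powr (2 * m)) R d"
    and u: "test_function (ball 0 R) u"
  shows "ennreal ((n + 2 * m)\<^sup>2 * (n - 2 * m - 4)\<^sup>2 / 16) *
          (\<integral>\<^sup>+x\<in>ball 0 R. ennreal ((u x)\<^sup>2 / norm x powr (2 * m + 4)) \<partial>lborel)
      + ennreal c * ennreal ((n + 2 * m)\<^sup>2 / 4) *
          (\<integral>\<^sup>+x\<in>ball 0 R. ennreal (W (norm x) / norm x powr (2 * m + 2) * (u x)\<^sup>2) \<partial>lborel)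
      + ennreal d * (\<integral>\<^sup>+x\<in>ball 0 R. ennreal ((norm (grad u x))\<^sup>2) \<partial>lborel)
    \<le> (\<integral>\<^sup>+x\<in>ball 0 R. ennreal (\<bar>laplacian u x\<bar>\<^sup>2 / norm x powr (2 * m)) \<partial>lborel)"
    (is "ennreal ?A * ?N1 + ennreal c * ennreal ?B * ?N2 + ennreal d * ?N3 \<le> ?L")
proof -
  define q where "q = 2 * m + 4"
  have q: "2 \<le> q" "q \<le> CARD('n)" "q - 4 = 2 * m" using m by (auto simp: q_def n_def)
  obtain b where b: "b < R" "vanishes_beyond b u" by (rule test_function_radius[OF u R])
  have su: "smooth u" using u by (simp add: test_function_def smooth_def)
  have cont_u: "continuous_on S u" for S by (rule smooth_continuous[OF su])
  have cont_grad: "continuous_on S (\<lambda>x. (norm (grad u x))\<^sup>2)" for S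
    unfolding norm_grad_squared by (intro continuous_intros smooth_continuous smooth_partial_deriv su)
  have grad0: "norm (grad u x) = 0" if "R \<le> norm x" for x
    using vanishes_beyond_partial_deriv[OF b(2)] b(1) that
    by (simp add: grad_def vanishes_beyond_def vec_eq_iff)
  obtain s s' where s: "riccati_solution (\<lambda>r. c * W r * r\<^sup>2) R s s'"
    by (rule bessel_riccati[OF W c])
  obtain t t' where t: "riccati_solution (\<lambda>r. d * r powr (q - 4) * r\<^sup>2) R t t'"
    unfolding q(3) by (rule bessel_riccati[OF _ _ d]) (auto intro!: continuous_intros)
  \<comment> \<open>The integrand of the cutoff error in \<open>hardy_rellich_cutoff\<close>, built
    from products of functions that vanish to first order at the origin.\<close>
  define h where "h = (\<lambda>x. (real CARD('n) - 2) * (euler u x)\<^sup>2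
          - (\<Sum>i\<in>UNIV. \<Sum>j\<in>UNIV. angular i j u x * euler (angular i j u) x))"
  have "quadratic_growth h"
    unfolding h_def power2_eq_square
    by (intro quadratic_growth_diff quadratic_growth_cmult quadratic_growth_sum quadratic_growth_mult
        linear_growth_euler[OF smooth_angular[OF su] vanishes_beyond_angular[OF b(2)]]
        linear_growth_euler[OF su b(2)] linear_growth_angular[OF su b(2)])
  then obtain C0 where C0: "\<And>x. \<bar>h x\<bar> \<le> C0 * (norm x)\<^sup>2" unfolding quadratic_growth_def by blast
  define C where "C = \<bar>C0\<bar>"
  have C: "0 \<le> C" "h x \<le> C * (norm x)\<^sup>2" for x
  proof -
    have "h x \<le> C0 * (norm x)\<^sup>2" using C0[of x] by linarith
    also have "\<dots> \<le> C * (norm x)\<^sup>2" by (intro mult_right_mono) (auto simp: C_def)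
    finally show "h x \<le> C * (norm x)\<^sup>2" .
  qed (simp add: C_def)
  define K where "K = 8 * C * (unit_ball_vol (CARD('n)) * 2 ^ CARD('n))"
  let ?g1 = "\<lambda>x. (u x)\<^sup>2 / norm x powr (2 * m + 4)"
  let ?g2 = "\<lambda>x. W (norm x) / norm x powr (2 * m + 2) * (u x)\<^sup>2"
  let ?g3 = "\<lambda>x. (norm (grad u x))\<^sup>2"
  define I where "I = (\<lambda>(g :: real ^ 'n \<Rightarrow> real) k.
    \<integral>\<^sup>+x\<in>ball 0 R. ennreal (cutoff (norm x / (1 / Suc k)) * g x) \<partial>lborel)"
  have step: "ennreal ?A * I ?g1 k + ennreal c * ennreal ?B * I ?g2 k + ennreal d * I ?g3 k
      \<le> ?L + ennreal (K * (1 / Suc k)\<^sup>2)" for k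
  proof -
    define \<epsilon> where "\<epsilon> = 1 / real (Suc k)"
    have \<epsilon>: "0 < \<epsilon>" "\<epsilon> \<le> 1" by (auto simp: \<epsilon>_def)
    interpret cw: cutoff_weight \<epsilon> b R q "\<lambda>r. cutoff (r / \<epsilon>)" "\<lambda>r. cutoff' (r / \<epsilon>) * (1 / \<epsilon>)" "TYPE('n)"
      using radial_weight_cutoff[OF \<epsilon>(1), of R] b q \<epsilon> by unfold_locales (auto simp: cutoff_nonneg)
    have adm: "cw.adm u" by (simp add: cw.adm_def su b)
    have contW: "continuous_on {0<..<R} (\<lambda>r. W r * r\<^sup>2)" by (intro continuous_intros W)
    have u0: "u x = 0" if "R \<le> norm x" for x using b that by (simp add: vanishes_beyond_def)
    let ?J1 = "cw.J (\<lambda>x. (u x)\<^sup>2)"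
    let ?J2 = "integral\<^sup>L lborel (\<lambda>x. cw.P (norm x) * (W (norm x) * (norm x)\<^sup>2) * (u x)\<^sup>2)"
    let ?J3 = "integral\<^sup>L lborel (\<lambda>x. cutoff (norm x / \<epsilon>) * (norm (grad u x))\<^sup>2)"
    let ?JL = "cw.J (\<lambda>x. ((norm x)\<^sup>2 * laplacian u x)\<^sup>2)"
    have 1: "I ?g1 k = ennreal ?J1"
      unfolding I_def cw.J_def \<epsilon>_def[symmetric]
    proof (rule nn_integral_ball_eq_integral)
      show "integrable lborel (\<lambda>x. cw.P (norm x) * (u x)\<^sup>2)"
        by (rule cw.integrable_P(1)[OF cw.adm_square[OF adm]])
    qed (simp_all add: cw.P_nonneg u0, simp add: cw.P_def q_def[symmetric] powr_minus_divide)
    have P2: "cw.P r * (W r * r\<^sup>2) = cutoff (r / \<epsilon>) * (W r / r powr (2 * m + 2))" if "0 \<le> r" for r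
    proof (cases "r = 0")
      case False
      with that have "r powr (- q) * r\<^sup>2 = r powr (- q + 2)"
        unfolding powr_add by simp
      also have "- q + 2 = - (2 * m + 2)" by (simp add: q_def)
      finally have "r powr (- q) * r\<^sup>2 = 1 / r powr (2 * m + 2)"
        unfolding powr_minus_divide .
      moreover have "cw.P r * (W r * r\<^sup>2) = cutoff (r / \<epsilon>) * W r * (r powr (- q) * r\<^sup>2)"
        by (simp add: cw.P_def mult_ac)
      ultimately show ?thesis by simp
    qed (simp add: cutoff_eq_0 cw.P_def)
    have 2: "I ?g2 k = ennreal ?J2"
      unfolding I_def \<epsilon>_def[symmetric]
    proof (rule nn_integral_ball_eq_integral)
      show "integrable lborel (\<lambda>x. cw.P (norm x) * (W (norm x) * (norm x)\<^sup>2) * (u x)\<^sup>2)"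
        by (rule cw.integrable_weighted[OF contW cw.adm_square[OF adm]])
      show "0 \<le> cw.P (norm x) * (W (norm x) * (norm x)\<^sup>2) * (u x)\<^sup>2" if "norm x < R" for x
        using W(2)[of "norm x"] that by (cases "x = 0") (simp_all add: cw.P_nonneg)
    qed (simp_all add: P2 u0)
    have 3: "I ?g3 k = ennreal ?J3"
      unfolding I_def \<epsilon>_def[symmetric]
    proof (rule nn_integral_ball_eq_integral)
      show "integrable lborel (\<lambda>x. cutoff (norm x / \<epsilon>) * (norm (grad u x))\<^sup>2)"
        using grad0 b \<epsilon> vanishes_beyond_partial_deriv[OF b(2)]
        by (intro integrable_radial[of R "\<lambda>r. cutoff (r / \<epsilon>)" \<epsilon> b] cont_grad
            radial_weight_continuous[OF radial_weight_cutoff])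
          (auto simp: cutoff_eq_0 vanishes_beyond_def grad_def vec_eq_iff)
    qed (simp_all add: grad0 cutoff_nonneg)
    have L: "ennreal ?JL \<le> ?L"
    proof -
      have lap: "cw.adm (\<lambda>x. ((norm x)\<^sup>2 * laplacian u x)\<^sup>2)"
        unfolding laplacian_euler_angular[OF su] by (intro cw.adm_intros adm)
      have PL: "cw.P (norm x) * ((norm x)\<^sup>2 * laplacian u x)\<^sup>2
          = cutoff (norm x / \<epsilon>) * (\<bar>laplacian u x\<bar>\<^sup>2 / norm x powr (2 * m))" for x
      proof (cases "x = 0")
        case False
        then have "norm x powr (- q) * (norm x ^ 4) = norm x powr (- (2 * m))"
          by (simp add: q_def powr_add[symmetric] flip: powr_numeral)
        then have "norm x powr (- q) * ((norm x)\<^sup>2)\<^sup>2 = 1 / norm x powr (2 * m)"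
          by (simp add: powr_minus_divide)
        moreover have "cw.P (norm x) * ((norm x)\<^sup>2 * laplacian u x)\<^sup>2
            = cutoff (norm x / \<epsilon>) * (laplacian u x)\<^sup>2 * (norm x powr (- q) * ((norm x)\<^sup>2)\<^sup>2)"
          by (simp add: cw.P_def power_mult_distrib mult_ac)
        ultimately show ?thesis by simp
      qed (simp add: cutoff_eq_0)
      have "ennreal ?JL = (\<integral>\<^sup>+x\<in>ball 0 R. ennreal (cutoff (norm x / \<epsilon>) * (\<bar>laplacian u x\<bar>\<^sup>2 / norm x powr (2 * m))) \<partial>lborel)"
        unfolding cw.J_def
      proof (rule nn_integral_ball_eq_integral[symmetric])
        show "cw.P (norm x) * ((norm x)\<^sup>2 * laplacian u x)\<^sup>2 = 0" if "R \<le> norm x" for x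
          using lap that b by (auto simp: cw.adm_def vanishes_beyond_def)
        show "integrable lborel (\<lambda>x. cw.P (norm x) * ((norm x)\<^sup>2 * laplacian u x)\<^sup>2)"
          by (rule cw.integrable_P(1)[OF lap])
        show "0 \<le> cw.P (norm x) * ((norm x)\<^sup>2 * laplacian u x)\<^sup>2" for x
          by (simp add: cw.P_nonneg)
      qed (simp add: PL)
      also have "\<dots> \<le> ?L"
        by (intro nn_integral_mono mult_right_mono ennreal_leI mult_left_le_one_le cutoff_nonneg cutoff_le_1) auto
      finally show ?thesis .
    qed
    have err: "cw.J' h \<le> K * \<epsilon>\<^sup>2"
      unfolding K_def cw.J'_def cw.P'_def
    proof (rule integral_over_shell_le[OF \<epsilon> q(1,2) C])
      have "cw.adm h" unfolding h_def by (intro cw.adm_intros adm)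
      from cw.integrable_P(2)[OF this]
      show "integrable lborel (\<lambda>x. norm x * (cutoff' (norm x / \<epsilon>) * (1 / \<epsilon>)) * norm x powr - q * h x)"
        unfolding cw.P'_def .
    qed
    have "integral\<^sup>L lborel (\<lambda>x. cw.P (norm x) * (c * W (norm x) * (norm x)\<^sup>2) * (u x)\<^sup>2) = c * ?J2"
      by (subst integral_mult_right_zero[symmetric]) (simp add: mult_ac)
    then have "((n + q - 4) / 2)\<^sup>2 * (((n - q) / 2)\<^sup>2 * ?J1 + c * ?J2) + d * ?J3 \<le> ?JL + cw.J' h"
      using cw.hardy_rellich_cutoff[OF adm s d(1) t] by (simp add: h_def n_def)
    \<comment> \<open>With q = 2 m + 4 one has n + q - 4 = n + 2 m and n - q = n - 2 m - 4.\<close>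
    also have "((n + q - 4) / 2)\<^sup>2 * (((n - q) / 2)\<^sup>2 * ?J1 + c * ?J2) = ?A * ?J1 + c * ?B * ?J2"
      by (simp add: q_def power2_eq_square field_simps)
    finally have real: "?A * ?J1 + c * ?B * ?J2 + d * ?J3 \<le> ?JL + K * \<epsilon>\<^sup>2"
      using err by simp
    have nonneg: "0 \<le> ?J1" "0 \<le> ?J2" "0 \<le> ?J3"
    proof -
      show "0 \<le> ?J1" by (simp add: cw.J_nonneg)
      show "0 \<le> ?J2"
      proof (rule integral_nonneg_AE, rule AE_I2)
        fix x show "0 \<le> cw.P (norm x) * (W (norm x) * (norm x)\<^sup>2) * (u x)\<^sup>2"
          using W(2)[of "norm x"] u0[of x] by (cases "x = 0"; cases "norm x < R") (simp_all add: cw.P_nonneg)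
      qed
      show "0 \<le> ?J3" by (intro integral_nonneg_AE AE_I2) (simp add: cutoff_nonneg)
    qed
    have "ennreal ?A * I ?g1 k + ennreal c * ennreal ?B * I ?g2 k + ennreal d * I ?g3 k
        = ennreal (?A * ?J1 + c * ?B * ?J2 + d * ?J3)"
    proof -
      have "ennreal a * ennreal x + ennreal c * ennreal b * ennreal y + ennreal d * ennreal z
          = ennreal (a * x + c * b * y + d * z)"
        if "0 \<le> a" "0 \<le> x" "0 \<le> c" "0 \<le> b" "0 \<le> y" "0 \<le> d" "0 \<le> z" for a x c b y d z :: real
        using that by (simp add: ennreal_mult)
      then show ?thesis unfolding 1 2 3 using nonneg c(1) d(1) by simp
    qed
    also have "\<dots> \<le> ennreal (?JL + K * \<epsilon>\<^sup>2)" by (rule ennreal_leI[OF real])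
    also have "\<dots> = ennreal ?JL + ennreal (K * \<epsilon>\<^sup>2)"
      by (rule ennreal_plus) (simp_all add: cw.J_nonneg K_def C(1))
    also have "\<dots> \<le> ?L + ennreal (K * \<epsilon>\<^sup>2)" by (rule add_right_mono[OF L])
    finally show ?thesis by (simp add: \<epsilon>_def)
  qed
  have I1: "I ?g1 \<longlonglongrightarrow> ?N1"
    unfolding I_def by (rule nn_integral_cutoff_limit) (auto intro!: continuous_intros cont_u)
  have "continuous_on (ball 0 R - {0}) (\<lambda>x :: real ^ 'n. W (norm x))"
    by (rule continuous_on_compose2[OF W(1) continuous_on_norm_id]) auto
  then have I2: "I ?g2 \<longlonglongrightarrow> ?N2"
    unfolding I_def using W(2)
    by (intro nn_integral_cutoff_limit) (auto intro!: continuous_intros cont_u)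
  have I3: "I ?g3 \<longlonglongrightarrow> ?N3"
    unfolding I_def by (rule nn_integral_cutoff_limit) (auto intro!: cont_grad)
  from I1 I2 I3 have "(\<lambda>k. ennreal ?A * I ?g1 k + ennreal c * ennreal ?B * I ?g2 k + ennreal d * I ?g3 k)
      \<longlonglongrightarrow> ennreal ?A * ?N1 + ennreal c * ennreal ?B * ?N2 + ennreal d * ?N3"
    by (intro tendsto_add ennreal_tendsto_cmult) (auto simp: ennreal_mult_less_top)
  moreover have "(\<lambda>k. ?L + ennreal (K * (1 / Suc k)\<^sup>2)) \<longlonglongrightarrow> ?L + ennreal (K * 0\<^sup>2)"
    by (intro tendsto_intros lim_1_over_n[THEN LIMSEQ_Suc])
  ultimately have "ennreal ?A * ?N1 + ennreal c * ennreal ?B * ?N2 + ennreal d * ?N3 \<le> ?L + ennreal (K * 0\<^sup>2)"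
    by (rule LIMSEQ_le) (use step in blast)
  then show ?thesis by simp
qed

section \<open>Passage to the suprema over the constants\<close>

theorem theorem3p15:
  fixes m R :: real and W :: "real \<Rightarrow> real" and u :: "real ^ 'n::finite \<Rightarrow> real" and n :: real
  defines "n \<equiv> real CARD('n)"
  assumes "R > 0"
    and "-1 < m" and "m \<le> (n - 4) / 2"
    and "bessel_potential W R"
    and "test_function (ball 0 R) u"
  shows "(\<integral>\<^sup>+x\<in>ball 0 R. ennreal (\<bar>laplacian u x\<bar>\<^sup>2 / norm x powr (2 * m)) \<partial>lborel)
    \<ge> ennreal ((n + 2 * m)\<^sup>2 * (n - 2 * m - 4)\<^sup>2 / 16) *
          (\<integral>\<^sup>+x\<in>ball 0 R. ennreal ((u x)\<^sup>2 / norm x powr (2 * m + 4)) \<partial>lborel)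
      + bessel_weight W R * ennreal ((n + 2 * m)\<^sup>2 / 4) *
          (\<integral>\<^sup>+x\<in>ball 0 R. ennreal (W (norm x) / norm x powr (2 * m + 2) * (u x)\<^sup>2) \<partial>lborel)
      + bessel_weight (\<lambda>r. r powr (2 * m)) R *
          (\<integral>\<^sup>+x\<in>ball 0 R. ennreal ((norm (grad u x))\<^sup>2) \<partial>lborel)"
    (is "?T1 + bessel_weight W R * ?B * ?N2 + bessel_weight ?p R * ?N3 \<le> ?L")
proof -
  let ?S = "\<lambda>V. {c. c > 0 \<and> has_positive_bessel_solution V R c}"
  have W: "continuous_on {0<..<R} W" "\<And>r. r \<in> {0<..<R} \<Longrightarrow> 0 \<le> W r" and ne: "?S W \<noteq> {}"
    using assms(5) by (auto simp: bessel_potential_def intro: C1_differentiable_imp_continuous_on)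
  have bound: "?T1 + ennreal c * ?B * ?N2 + ennreal d * ?N3 \<le> ?L"
    if "c \<in> ?S W" "d = 0 \<or> d \<in> ?S ?p" for c d
  proof -
    \<comment> \<open>The constant function 1 solves the equation with constant 0.\<close>
    have "has_positive_bessel_solution ?p R 0"
      unfolding has_positive_bessel_solution_def
      by (intro exI[of _ "\<lambda>_. 1"] exI[of _ "\<lambda>_. 0"]) auto
    then show ?thesis
      using that assms W unfolding n_def
      by (intro hardy_rellich_admissible_constants) auto
  qed
  have weight: "bessel_weight V R * z = (SUP c\<in>?S V. ennreal c * z)" for V z
    unfolding bessel_weight_def by (rule SUP_mult_right_ennreal)
  have W_bound: "?T1 + bessel_weight W R * ?B * ?N2 + ennreal d * ?N3 \<le> ?L" if "d = 0 \<or> d \<in> ?S ?p" for d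
  proof -
    \<comment> \<open>In the extended nonnegative reals multiplication commutes with suprema, and
      addition does so over nonempty index sets. Such a set is provided by \<open>ne\<close>, since
      \<open>W\<close> is a Bessel potential.\<close>
    have "?T1 + bessel_weight W R * ?B * ?N2 + ennreal d * ?N3
        = (SUP c\<in>?S W. ?T1 + ennreal c * ?B * ?N2 + ennreal d * ?N3)"
      using weight[of W "?B * ?N2"]
      by (simp only: mult.assoc ennreal_SUP_add_right[OF ne] ennreal_SUP_add_left[OF ne])
    also have "\<dots> \<le> ?L" using bound that by (intro SUP_least) auto
    finally show ?thesis .
  qed
  show ?thesis
  proof (cases "?S ?p = {}")
    case True
    \<comment> \<open>The supremum of the empty set is 0, so the Dirichlet term drops out and the
      bound with \<open>d = 0\<close> suffices.\<close>
    then have "bessel_weight ?p R = 0" unfolding bessel_weight_def True by (simp add: bot_ennreal)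
    then show ?thesis using W_bound[of 0] by simp
  next
    case False
    then have "?T1 + bessel_weight W R * ?B * ?N2 + bessel_weight ?p R * ?N3
        = (SUP d\<in>?S ?p. ?T1 + bessel_weight W R * ?B * ?N2 + ennreal d * ?N3)"
      unfolding weight[of ?p] by (rule ennreal_SUP_add_right)
    also have "\<dots> \<le> ?L" using W_bound by (intro SUP_least) auto
    finally show ?thesis .
  qed
qed

end
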